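(* The following decision problem (the Common Term problem for dwindling convergent string-rewriting systems) is undecidable. Given a finite non-empty alphabet $\Sigma$, strings $\alpha,\beta\in\Sigma^*$, and a finite string-rewriting system $S$ over $\Sigma$ that is dwindling and convergent, decide whether there exists a string $W\in\Sigma^*$ such that $\alpha W \approx_S \beta W$, i.e. $\alpha W \stackrel{*}{\longleftrightarrow}_S \beta W$.
   Context: A string-rewriting system (SRS) $S$ over $\Sigma$ is a set of rules $l\to r$ with $l,r\in\Sigma^*$; the one-step reduction is $\to_S=\{(xly,xry): (l\to r)\in S,\ x,y\in\Sigma^*\}$, $\stackrel{*}{\longleftrightarrow}_S$ (also written $\approx_S$) is the reflexive, symmetric, transitive closure of $\to_S$. $S$ is terminating if there is no infinite chain $u_0\to_S u_1\to_S\cdots$; confluent if whenever $s_1 \leftarrow_S^* t\to_S^* s_2$ there is $t'$ with $s_1\to_S^* t' \leftarrow_S^* s_2$; convergent if both terminating and confluent. $S$ is dwindling if for every rule $l\to r$ in $S$, $r$ is a proper prefix of $l$. *)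

theory Defs
  imports "HOL-Library.Confluence" "HOL-Library.Sublist" "HOL-Library.Nat_Bijection"
begin

section \<open>String-rewriting systems\<close>

text \<open>Strings over an alphabet \<open>\<Sigma>\<close> are the elements of \<^term>\<open>lists \<Sigma>\<close>.\<close>

type_synonym 'a srs = "('a list \<times> 'a list) set"

definition srs_over :: "'a set \<Rightarrow> 'a srs \<Rightarrow> bool" where
  "srs_over \<Sigma> S \<longleftrightarrow> S \<subseteq> lists \<Sigma> \<times> lists \<Sigma>"

definition reduces :: "'a set \<Rightarrow> 'a srs \<Rightarrow> 'a list \<Rightarrow> 'a list \<Rightarrow> bool" where
  "reduces \<Sigma> S u v \<longleftrightarrow>
     (\<exists>l r x y. (l, r) \<in> S \<and> x \<in> lists \<Sigma> \<and> y \<in> lists \<Sigma> \<and> u = x @ l @ y \<and> v = x @ r @ y)"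

definition terminating :: "'a set \<Rightarrow> 'a srs \<Rightarrow> bool" where
  "terminating \<Sigma> S \<longleftrightarrow> \<not> (\<exists>u :: nat \<Rightarrow> 'a list. \<forall>i. reduces \<Sigma> S (u i) (u (Suc i)))"

definition convergent :: "'a set \<Rightarrow> 'a srs \<Rightarrow> bool" where
  "convergent \<Sigma> S \<longleftrightarrow> terminating \<Sigma> S \<and> confluentp (reduces \<Sigma> S)"

definition dwindling :: "'a srs \<Rightarrow> bool" where
  "dwindling S \<longleftrightarrow> (\<forall>(l, r) \<in> S. strict_prefix r l)"

definition srs_equiv :: "'a set \<Rightarrow> 'a srs \<Rightarrow> 'a list \<Rightarrow> 'a list \<Rightarrow> bool" where
  "srs_equiv \<Sigma> S = equivclp (reduces \<Sigma> S)"

definition has_common_term :: "'a set \<Rightarrow> 'a srs \<Rightarrow> 'a list \<Rightarrow> 'a list \<Rightarrow> bool" where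
  "has_common_term \<Sigma> S \<alpha> \<beta> \<longleftrightarrow> (\<exists>W \<in> lists \<Sigma>. srs_equiv \<Sigma> S (\<alpha> @ W) (\<beta> @ W))"


section \<open>Partial recursive functions\<close>

text \<open>
  Kleene's partial recursive functions. Terms carry no arity: \<^term>\<open>computes f xs y\<close> says that
  \<open>f\<close>, read as a function of \<open>length xs\<close> arguments, is defined at \<open>xs\<close> with value \<open>y\<close>; it is
  defined nowhere at arities that do not fit. Primitive recursion and minimisation act on the
  first argument.
\<close>

datatype recf =
    Zero
  | Succ
  | Proj nat
  | Comp recf "recf list"
  | PrimRec recf recf
  | Mu recf

inductive computes :: "recf \<Rightarrow> nat list \<Rightarrow> nat \<Rightarrow> bool" where
  Zero: "computes Zero xs 0"
| Succ: "computes Succ [x] (Suc x)"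
| Proj: "i < length xs \<Longrightarrow> computes (Proj i) xs (xs ! i)"
| Comp: "length ys = length gs \<Longrightarrow> (\<And>i. i < length gs \<Longrightarrow> computes (gs ! i) xs (ys ! i)) \<Longrightarrow>
    computes f ys z \<Longrightarrow> computes (Comp f gs) xs z"
| PrimRec_0: "computes f xs y \<Longrightarrow> computes (PrimRec f g) (0 # xs) y"
| PrimRec_Suc: "computes (PrimRec f g) (n # xs) y \<Longrightarrow> computes g (n # y # xs) z \<Longrightarrow>
    computes (PrimRec f g) (Suc n # xs) z"
| Mu: "computes f (n # xs) 0 \<Longrightarrow> (\<And>m. m < n \<Longrightarrow> \<exists>y. computes f (m # xs) (Suc y)) \<Longrightarrow>
    computes (Mu f) xs n"

inductive_cases computes_ZeroE: "computes Zero xs y"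
inductive_cases computes_SuccE: "computes Succ xs y"
inductive_cases computes_ProjE: "computes (Proj i) xs y"
inductive_cases computes_CompE: "computes (Comp f gs) xs y"
inductive_cases computes_PrimRec_0E: "computes (PrimRec f g) (0 # xs) y"
inductive_cases computes_PrimRec_SucE: "computes (PrimRec f g) (Suc n # xs) y"
inductive_cases computes_MuE: "computes (Mu f) xs y"

lemma computes_functional: "computes f xs y \<Longrightarrow> computes f xs z \<Longrightarrow> y = z"
proof (induction arbitrary: z rule: computes.induct)
  case (Zero xs)
  then show ?case by (auto elim: computes_ZeroE)
next
  case (Succ x)
  then show ?case by (auto elim: computes_SuccE)
next
  case (Proj i xs)
  then show ?case by (auto elim: computes_ProjE)
next
  case (Comp ys gs xs f w)
  from Comp.prems obtain ys' where ys': "length ys' = length gs"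
    "\<And>i. i < length gs \<Longrightarrow> computes (gs ! i) xs (ys' ! i)" "computes f ys' z"
    by (rule computes_CompE) blast
  have "ys = ys'"
  proof (rule nth_equalityI)
    show "length ys = length ys'" using Comp.hyps(1) ys'(1) by simp
    show "ys ! i = ys' ! i" if "i < length ys" for i
      using that Comp.hyps(1) Comp.IH(1) ys'(2) by metis
  qed
  then show ?case using Comp.IH(2) ys'(3) by blast
next
  case (PrimRec_0 f xs y g)
  then show ?case by (blast elim: computes_PrimRec_0E)
next
  case (PrimRec_Suc f g n xs y w)
  from PrimRec_Suc.prems obtain y' where
    "computes (PrimRec f g) (n # xs) y'" "computes g (n # y' # xs) z"
    by (rule computes_PrimRec_SucE) blast
  then show ?case using PrimRec_Suc.IH by blast
next
  case (Mu f n xs)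
  have z0: "computes f (z # xs) 0"
    using Mu.prems by (rule computes_MuE)
  have z1: "\<exists>y. computes f (m # xs) (Suc y)" if "m < z" for m
    using Mu.prems that by (blast elim: computes_MuE)
  have "\<not> z < n" using Mu.IH(2) z0 by (metis nat.distinct(1))
  moreover have "\<not> n < z" using Mu.IH(1) z1 by (metis nat.distinct(1))
  ultimately show ?case by simp
qed


section \<open>Decision problems\<close>

text \<open>
  \<^term>\<open>decidable_problem enc I Y\<close>: some algorithm, run on the code of any instance in \<open>I\<close>, halts
  and outputs 1 or 0 according to whether the instance is in \<open>Y\<close>. Its behaviour on numbers that do
  not code an instance in \<open>I\<close> is irrelevant.
\<close>

definition decidable_problem :: "('i \<Rightarrow> nat) \<Rightarrow> 'i set \<Rightarrow> 'i set \<Rightarrow> bool" where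
  "decidable_problem enc I Y \<longleftrightarrow>
     (\<exists>f. \<forall>x \<in> I. computes f [enc x] (if x \<in> Y then 1 else 0))"


section \<open>Instances of the Common Term problem\<close>

text \<open>
  An instance \<open>(k, \<alpha>, \<beta>, rs)\<close> stands for the alphabet \<^term>\<open>{..<k}\<close>, the strings \<open>\<alpha>\<close> and \<open>\<beta>\<close>,
  and the system whose rules are listed in \<open>rs\<close>.
\<close>

type_synonym ct_instance = "nat \<times> nat list \<times> nat list \<times> (nat list \<times> nat list) list"

definition encode_rule :: "nat list \<times> nat list \<Rightarrow> nat" where
  "encode_rule = (\<lambda>(l, r). prod_encode (list_encode l, list_encode r))"

definition encode_instance :: "ct_instance \<Rightarrow> nat" where
  "encode_instance = (\<lambda>(k, \<alpha>, \<beta>, rs).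
     list_encode [k, list_encode \<alpha>, list_encode \<beta>, list_encode (map encode_rule rs)])"

lemma inj_encode_rule: "inj encode_rule"
  by (auto simp: inj_def encode_rule_def inj_eq[OF inj_list_encode])

lemma inj_encode_instance: "inj encode_instance"
  by (auto simp: inj_def encode_instance_def inj_eq[OF inj_list_encode]
      inj_map_eq_map[OF inj_encode_rule] simp del: list_encode.simps)

definition dwindling_ct_instances :: "ct_instance set" where
  "dwindling_ct_instances = {(k, \<alpha>, \<beta>, rs).
     k > 0 \<and> \<alpha> \<in> lists {..<k} \<and> \<beta> \<in> lists {..<k} \<and> srs_over {..<k} (set rs) \<and>
     dwindling (set rs) \<and> convergent {..<k} (set rs)}"

definition ct_yes_instances :: "ct_instance set" where
  "ct_yes_instances = {(k, \<alpha>, \<beta>, rs). has_common_term {..<k} (set rs) \<alpha> \<beta>}"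

end

theory Submission
  imports Defs "HOL-Library.Countable_Set"
begin

text \<open>
  Rules of the form \<open>x y m \<rightarrow> r\<close> with a fixed marker \<open>m\<close> and \<open>r\<close> a prefix of \<open>x y\<close> never overlap, so any
  partial table \<open>(x, y) \<mapsto> r\<close> is a dwindling convergent system. Its normal forms are computed by a
  stack: a marked letter is pushed, pops the top, or is dropped, depending on the top.

  The word \<open>W\<close> lists, in turn, configurations of a counter program and strings of transition labels
  in reverse. After \<open>\<alpha>\<close>, a configuration is pushed and then popped by the labels that rewrite it;
  after \<open>\<beta>\<close>, the labels are pushed and then popped by the letters of the next configuration. So the
  two readings check alternate halves of one computation, and they can reach the same stack only if
  it halts. A configuration may grow because padding letters are dropped from an empty stack.

  Given a decider, the recursive function that computes the code of an instance from the code of its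
  rules and halts iff the decider answers 0 is compiled into rules and run on the code of these.
\<close>

section \<open>Compiling recursive functions to counter programs\<close>

text \<open>A dwindling rule only deletes, so the system cannot write anything: every configuration
  must be supplied by \<open>W\<close>, and the rules merely verify it. Nondeterministic programs
  cost nothing, since the labels in \<open>W\<close> pick the branch. The obstacle is that
  \<open>W\<close> is arbitrary: it may contain letters without markers, markers without letters,
  and symbols that only one side accepts, and none of this may let the stacks meet.

  No reduction from a halting problem is computed. The rules reach the recursive function only as a
  number, so the compilation itself never has to be shown recursive; only the assembly of an
  instance around that number has to be. In return, whatever that assembly mentions must be fixed
  before the program is known, because the program contains it. This is why the symbols of all
  programs share one coding, why the initial program is represented in the words by the anonymous
  symbol \<open>Init\<close>, and why only the rules know what \<open>Init\<close> stands
  for.\<close>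

datatype instr = Nop | Inc nat | Dec nat | IsZero nat

fun isem :: "instr \<Rightarrow> (nat \<Rightarrow> nat) \<Rightarrow> (nat \<Rightarrow> nat) \<Rightarrow> bool" where
  "isem Nop s t \<longleftrightarrow> t = s"
| "isem (Inc r) s t \<longleftrightarrow> t = s(r := Suc (s r))"
| "isem (Dec r) s t \<longleftrightarrow> s r > 0 \<and> t = s(r := s r - 1)"
| "isem (IsZero r) s t \<longleftrightarrow> s r = 0 \<and> t = s"

text \<open>Regular commands: \<open>Star\<close> guesses the number of iterations, and a guard
  behind it discards the wrong guesses. Only the existence of a complete run matters.\<close>

datatype cmd = Prim instr | Seq cmd cmd | Star cmd

primrec sem :: "cmd \<Rightarrow> (nat \<Rightarrow> nat) rel" where
  "sem (Prim q) = {(s, t). isem q s t}"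
| "sem (Seq c d) = sem c O sem d"
| "sem (Star c) = (sem c)\<^sup>*"

lemma in_sem_Prim [simp]: "(s, t) \<in> sem (Prim q) \<longleftrightarrow> isem q s t"
  by simp

lemma in_sem_Seq [simp]: "(s, t) \<in> sem (Seq c d) \<longleftrightarrow> (\<exists>u. (s, u) \<in> sem c \<and> (u, t) \<in> sem d)"
  by auto

declare sem.simps(1,2) [simp del]

definition clear :: "nat \<Rightarrow> cmd" where
  "clear r = Seq (Star (Prim (Dec r))) (Prim (IsZero r))"

definition move :: "nat \<Rightarrow> nat \<Rightarrow> cmd" where
  "move r r' = Seq (Star (Seq (Prim (Dec r)) (Prim (Inc r')))) (Prim (IsZero r))"

text \<open>A register can be read only by emptying it, so \<open>r\<close> is refilled from the
  scratch register \<open>h\<close>.\<close>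

definition copy :: "nat \<Rightarrow> nat \<Rightarrow> nat \<Rightarrow> cmd" where
  "copy r r' h =
     Seq (Seq (Star (Seq (Prim (Dec r)) (Seq (Prim (Inc r')) (Prim (Inc h))))) (Prim (IsZero r)))
       (move h r)"

definition fail :: cmd where
  "fail = Seq (Prim (Inc 0)) (Prim (IsZero 0))"

lemma not_in_sem_fail [simp]: "(s, t) \<notin> sem fail"
  by (simp add: fail_def)

text \<open>Leaving the loop early is possible but fatal, since \<open>IsZero r\<close> then fails.
  So it suffices that the intended result \<open>F\<close> is constant along iterations and that
  some iteration lowers \<open>r\<close>.\<close>

lemma loop_iff:
  assumes inv: "\<And>s s'. (s, s') \<in> sem c \<Longrightarrow> F s' = F s"
    and exit: "\<And>s. s r = 0 \<Longrightarrow> F s = s"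
    and progress: "\<And>s. s r > 0 \<Longrightarrow> \<exists>s'. (s, s') \<in> sem c \<and> s' r < s r"
  shows "(s, t) \<in> sem (Seq (Star c) (Prim (IsZero r))) \<longleftrightarrow> t = F s"
proof
  assume "(s, t) \<in> sem (Seq (Star c) (Prim (IsZero r)))"
  then have "(s, t) \<in> (sem c)\<^sup>*" and "t r = 0"
    by auto
  from this(1) have "F t = F s"
    by (induction rule: rtrancl_induct) (auto dest: inv)
  with \<open>t r = 0\<close> show "t = F s"
    using exit by simp
next
  have "\<exists>t. (s, t) \<in> (sem c)\<^sup>* \<and> t r = 0 \<and> t = F s" for s
  proof (induction "s r" arbitrary: s rule: less_induct)
    case less
    show ?case
    proof (cases "s r = 0")
      case True
      then show ?thesis using exit by auto
    next
      case False
      then obtain s' where s': "(s, s') \<in> sem c" "s' r < s r"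
        using progress by blast
      with less obtain t where "(s', t) \<in> (sem c)\<^sup>*" "t r = 0" "t = F s'"
        by blast
      then show ?thesis
        using s' inv by (metis converse_rtrancl_into_rtrancl)
    qed
  qed
  then show "(s, t) \<in> sem (Seq (Star c) (Prim (IsZero r)))" if "t = F s"
    using that by auto
qed

lemma sem_clear [simp]: "(s, t) \<in> sem (clear r) \<longleftrightarrow> t = s(r := 0)"
  unfolding clear_def by (rule loop_iff) auto

lemma sem_move:
  "r \<noteq> r' \<Longrightarrow> (s, t) \<in> sem (move r r') \<longleftrightarrow> t = s(r := 0, r' := s r' + s r)"
  unfolding move_def by (rule loop_iff) (auto intro!: ext)

lemma sem_copy:
  assumes "r \<noteq> r'" "r \<noteq> h" "r' \<noteq> h" "s h = 0"
  shows "(s, t) \<in> sem (copy r r' h) \<longleftrightarrow> t = s(r' := s r' + s r)"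
proof -
  have "(s, u) \<in> sem (Seq (Star (Seq (Prim (Dec r)) (Seq (Prim (Inc r')) (Prim (Inc h)))))
      (Prim (IsZero r))) \<longleftrightarrow> u = s(r := 0, r' := s r' + s r, h := s h + s r)" for u
    by (rule loop_iff) (use assms in \<open>auto intro!: ext\<close>)
  moreover have "(s(r := 0, r' := s r' + s r, h := s h + s r))(h := 0, r := 0 + s r)
      = s(r' := s r' + s r)"
    using assms by (auto simp: fun_eq_iff)
  ultimately show ?thesis
    using assms unfolding copy_def by (subst in_sem_Seq) (simp add: sem_move)
qed

primrec clears :: "nat \<Rightarrow> nat \<Rightarrow> cmd" where
  "clears b 0 = Prim Nop"
| "clears b (Suc n) = Seq (clear (b + n)) (clears b n)"

lemma sem_clears:
  "(s, t) \<in> sem (clears b n) \<longleftrightarrow> t = (\<lambda>r. if b \<le> r \<and> r < b + n then 0 else s r)"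
proof (induction n arbitrary: s)
  case (Suc n)
  have "(\<lambda>r. if b \<le> r \<and> r < b + n then 0 else (s(b + n := 0)) r)
      = (\<lambda>r. if b \<le> r \<and> r < b + Suc n then 0 else s r)"
    by (auto simp: fun_eq_iff)
  with Suc show ?case by simp
qed auto

primrec evals :: "(nat list \<Rightarrow> nat \<Rightarrow> cmd) list \<Rightarrow> nat list \<Rightarrow> nat \<Rightarrow> cmd" where
  "evals [] args b = Prim Nop"
| "evals (c # cs) args b = Seq (c args b) (evals cs args (Suc b))"

text \<open>
  \<open>compile f args b\<close> reads the arguments of \<open>f\<close> from the registers \<open>args\<close>, all of them below \<open>b\<close>,
  and leaves the value in register \<open>b\<close>. The registers from \<open>b\<close> on are 0 at the start, and those
  above \<open>b\<close> are 0 again at the end.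
\<close>

primrec compile :: "recf \<Rightarrow> nat list \<Rightarrow> nat \<Rightarrow> cmd" where
  "compile Zero = (\<lambda>args b. Prim Nop)"
| "compile Succ = (\<lambda>args b.
     case args of [x] \<Rightarrow> Seq (copy x b (Suc b)) (Prim (Inc b)) | _ \<Rightarrow> fail)"
| "compile (Proj i) = (\<lambda>args b. if i < length args then copy (args ! i) b (Suc b) else fail)"
| "compile (Comp f gs) = (\<lambda>args b. let e = Suc b + length gs in
     Seq (evals (map compile gs) args (Suc b))
       (Seq (compile f [Suc b..<e] e) (Seq (clears (Suc b) (length gs)) (move e b))))"
| "compile (PrimRec f g) = (\<lambda>args b. case args of [] \<Rightarrow> fail | x # xs \<Rightarrow>
     Seq (compile f xs b) (Seq (copy x (b + 1) (b + 2))
       (Seq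
         (Star (Seq (Prim (Dec (b + 1))) (Seq (compile g ((b + 2) # b # xs) (b + 3))
           (Seq (clear b) (Seq (move (b + 3) b) (Prim (Inc (b + 2))))))))
         (Seq (Prim (IsZero (b + 1))) (clear (b + 2))))))"
| "compile (Mu f) = (\<lambda>args b.
     Seq
       (Star (Seq (compile f (b # args) (b + 1))
         (Seq (Prim (Dec (b + 1))) (Seq (clear (b + 1)) (Prim (Inc b))))))
       (Seq (compile f (b # args) (b + 1)) (Prim (IsZero (b + 1)))))"

section \<open>Correctness of the compilation\<close>

primrec upds :: "(nat \<Rightarrow> nat) \<Rightarrow> nat \<Rightarrow> nat list \<Rightarrow> nat \<Rightarrow> nat" where
  "upds s b [] = s"
| "upds s b (y # ys) = upds (s(b := y)) (Suc b) ys"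

lemma upds_outside: "r < b \<or> b + length ys \<le> r \<Longrightarrow> upds s b ys r = s r"
  by (induction ys arbitrary: s b) auto

lemma map_upds: "map (upds s b ys) [b..<b + length ys] = ys"
proof (induction ys arbitrary: s b)
  case (Cons y ys)
  have "[b..<b + length (y # ys)] = b # [Suc b..<Suc b + length ys]"
    by (subst upt_conv_Cons) simp_all
  then show ?case
    using Cons.IH[of "s(b := y)" "Suc b"] by (simp add: upds_outside del: upt_Suc fun_upd_apply) simp
qed simp

lemma computes_Comp_iff:
  "computes (Comp f gs) xs z \<longleftrightarrow> (\<exists>ys. list_all2 (\<lambda>g. computes g xs) gs ys \<and> computes f ys z)"
proof
  assume "computes (Comp f gs) xs z"
  then show "\<exists>ys. list_all2 (\<lambda>g. computes g xs) gs ys \<and> computes f ys z"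
    by (rule computes_CompE) (metis list_all2_all_nthI)
qed (auto simp: list_all2_conv_all_nth intro: computes.Comp)

lemma computes_Mu_iff:
  "computes (Mu f) xs n \<longleftrightarrow> (\<forall>m<n. \<exists>y. computes f (m # xs) (Suc y)) \<and> computes f (n # xs) 0"
proof
  assume "computes (Mu f) xs n"
  then show "(\<forall>m<n. \<exists>y. computes f (m # xs) (Suc y)) \<and> computes f (n # xs) 0"
    by (rule computes_MuE) simp
qed (simp add: computes.Mu)

lemma sem_evals:
  assumes IH: "\<And>g args b s t. g \<in> set gs \<Longrightarrow> \<forall>x\<in>set args. x < b \<Longrightarrow> \<forall>r\<ge>b. s r = 0 \<Longrightarrow>
      (s, t) \<in> sem (compile g args b) \<longleftrightarrow> (\<exists>y. computes g (map s args) y \<and> t = s(b := y))"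
    and args: "\<forall>x\<in>set args. x < b" and zero: "\<forall>r\<ge>b. s r = 0"
  shows "(s, t) \<in> sem (evals (map compile gs) args b) \<longleftrightarrow>
    (\<exists>ys. list_all2 (\<lambda>g. computes g (map s args)) gs ys \<and> t = upds s b ys)"
  using assms
proof (induction gs arbitrary: s b)
  case (Cons g gs)
  have fst: "(s, u) \<in> sem (compile g args b) \<longleftrightarrow>
      (\<exists>y. computes g (map s args) y \<and> u = s(b := y))" for u
    by (rule Cons.prems(1)) (use Cons.prems in simp_all)
  have snd: "(s(b := y), t) \<in> sem (evals (map compile gs) args (Suc b)) \<longleftrightarrow>
      (\<exists>ys. list_all2 (\<lambda>g. computes g (map s args)) gs ys \<and> t = upds s b (y # ys))" for y
  proof -
    have map: "map (s(b := y)) args = map s args"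
      using Cons.prems(2) by auto
    have "(s(b := y), t) \<in> sem (evals (map compile gs) args (Suc b)) \<longleftrightarrow>
        (\<exists>ys. list_all2 (\<lambda>g. computes g (map (s(b := y)) args)) gs ys \<and>
          t = upds (s(b := y)) (Suc b) ys)"
    proof (rule Cons.IH)
      show "(s, t) \<in> sem (compile g args b) \<longleftrightarrow>
          (\<exists>y. computes g (map s args) y \<and> t = s(b := y))"
        if "g \<in> set gs" "\<forall>x\<in>set args. x < b" "\<forall>r\<ge>b. s r = 0" for g args b s t
        by (rule Cons.prems(1)) (use that in simp_all)
    qed (use Cons.prems in \<open>auto simp: less_Suc_eq\<close>)
    then show ?thesis
      by (simp only: map upds.simps)
  qed
  have "(s, t) \<in> sem (evals (map compile (g # gs)) args b) \<longleftrightarrow> (\<exists>y. computes g (map s args) y \<and>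
      (\<exists>ys. list_all2 (\<lambda>g. computes g (map s args)) gs ys \<and> t = upds s b (y # ys)))"
    unfolding list.map evals.simps in_sem_Seq fst using snd by metis
  then show ?case
    unfolding list_all2_Cons1 by blast
qed simp

text \<open>Both directions matter: where \<open>f\<close> is undefined there must be no complete
  run at all. As the final state differs from \<open>s\<close> in register \<open>b\<close> only,
  the equivalence can be iterated inside loops.\<close>

lemma sem_compile:
  assumes "\<forall>x\<in>set args. x < b" and "\<forall>r\<ge>b. s r = 0"
  shows "(s, t) \<in> sem (compile f args b) \<longleftrightarrow> (\<exists>y. computes f (map s args) y \<and> t = s(b := y))"
  using assms
proof (induction f arbitrary: args b s t)
  case Zero
  then have "s(b := 0) = s" by auto
  then show ?case
    by (metis compile.simps(1) computes.Zero computes_ZeroE in_sem_Prim isem.simps(1))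
next
  case Succ
  show ?case
  proof (cases "\<exists>x. args = [x]")
    case True
    then obtain x where [simp]: "args = [x]" by blast
    have succ: "computes Succ [s x] y \<longleftrightarrow> y = Suc (s x)" for y
      by (auto intro: computes.Succ elim: computes_SuccE)
    have "(s, t) \<in> sem (compile Succ args b) \<longleftrightarrow> t = s(b := Suc (s x))"
      using Succ by (simp add: sem_copy)
    then show ?thesis
      by (simp only: \<open>args = [x]\<close> list.map succ ex_simps simp_thms)
  next
    case False
    then show ?thesis
      by (auto elim!: computes_SuccE split: list.splits)
  qed
next
  case (Proj i)
  show ?case
  proof (cases "i < length args")
    case True
    have proj: "computes (Proj i) (map s args) y \<longleftrightarrow> y = s (args ! i)" for y
      using True computes.Proj[of i "map s args"] by (auto elim: computes_ProjE)
    have "args ! i < b" using Proj True by simp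
    moreover have "s b = 0" "s (Suc b) = 0" using Proj by simp_all
    ultimately have "(s, t) \<in> sem (compile (Proj i) args b) \<longleftrightarrow> t = s(b := s (args ! i))"
      using True by (simp add: sem_copy)
    then show ?thesis
      by (simp only: proj ex_simps simp_thms)
  next
    case False
    then show ?thesis by (auto elim: computes_ProjE)
  qed
next
  case (Comp f gs)
  define e where "e = Suc b + length gs"
  have ev: "(s, u) \<in> sem (evals (map compile gs) args (Suc b)) \<longleftrightarrow>
      (\<exists>ys. list_all2 (\<lambda>g. computes g (map s args)) gs ys \<and> u = upds s (Suc b) ys)" for u
  proof (rule sem_evals)
    show "(s, t) \<in> sem (compile g args b) \<longleftrightarrow> (\<exists>y. computes g (map s args) y \<and> t = s(b := y))"
      if "g \<in> set gs" "\<forall>x\<in>set args. x < b" "\<forall>r\<ge>b. s r = 0" for g args b s t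
      by (rule Comp.IH(2)) fact+
  qed (use Comp.prems in auto)
  have out: "upds s (Suc b) ys r = 0" if "length ys = length gs" "r \<ge> e" for ys r
    using that Comp.prems by (simp add: upds_outside e_def)
  have f: "(upds s (Suc b) ys, u) \<in> sem (compile f [Suc b..<e] e) \<longleftrightarrow>
      (\<exists>z. computes f ys z \<and> u = (upds s (Suc b) ys)(e := z))" if "length ys = length gs" for ys u
  proof -
    have "map (upds s (Suc b) ys) [Suc b..<e] = ys"
      using map_upds[of s "Suc b" ys] that by (simp only: e_def)
    with Comp.IH(1)[of "[Suc b..<e]" e "upds s (Suc b) ys" u] out[OF that] show ?thesis
      by (simp del: fun_upd_apply)
  qed
  have fin: "(\<exists>v. ((upds s (Suc b) ys)(e := z), v) \<in> sem (clears (Suc b) (length gs)) \<and>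
      (v, t) \<in> sem (move e b)) \<longleftrightarrow> t = s(b := z)" if "length ys = length gs" for ys z
  proof -
    have "(\<lambda>r. if Suc b \<le> r \<and> r < Suc b + length gs then 0 else ((upds s (Suc b) ys)(e := z)) r)
        = s(e := z)"
      using Comp.prems that by (auto simp: fun_eq_iff e_def upds_outside)
    then have "(((upds s (Suc b) ys)(e := z), v) \<in> sem (clears (Suc b) (length gs))) \<longleftrightarrow>
        v = s(e := z)" for v
      unfolding sem_clears by (rule arg_cong)
    moreover have "s(e := z, e := 0, b := (s(e := z)) b + (s(e := z)) e) = s(b := z)"
      using Comp.prems by (auto simp: fun_eq_iff e_def)
    then have "(s(e := z), t) \<in> sem (move e b) \<longleftrightarrow> t = s(b := z)"
      by (subst sem_move) (auto simp: e_def)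
    ultimately show ?thesis by simp
  qed
  let ?E = "\<lambda>ys. list_all2 (\<lambda>g. computes g (map s args)) gs ys"
  let ?T = "\<lambda>u. \<exists>v. (u, v) \<in> sem (clears (Suc b) (length gs)) \<and> (v, t) \<in> sem (move e b)"
  have len: "length ys = length gs" if "?E ys" for ys
    using that by (simp add: list_all2_lengthD)
  have "(s, t) \<in> sem (compile (Comp f gs) args b) \<longleftrightarrow>
      (\<exists>ys. ?E ys \<and> (\<exists>u. (upds s (Suc b) ys, u) \<in> sem (compile f [Suc b..<e] e) \<and> ?T u))"
    unfolding compile.simps Let_def e_def[symmetric] in_sem_Seq ev by blast
  also have "\<dots> \<longleftrightarrow> (\<exists>ys. ?E ys \<and> (\<exists>z. computes f ys z \<and> t = s(b := z)))"
  proof (intro ex_cong1 conj_cong refl)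
    fix ys
    assume "?E ys"
    note len = len[OF this]
    show "(\<exists>u. (upds s (Suc b) ys, u) \<in> sem (compile f [Suc b..<e] e) \<and> ?T u) \<longleftrightarrow>
        (\<exists>z. computes f ys z \<and> t = s(b := z))"
      unfolding f[OF len] fin[OF len, symmetric] by blast
  qed
  also have "\<dots> \<longleftrightarrow> (\<exists>z. computes (Comp f gs) (map s args) z \<and> t = s(b := z))"
    unfolding computes_Comp_iff by blast
  finally show ?case .
next
  case (PrimRec f g)
  show ?case
  proof (cases args)
    case Nil
    then show ?thesis by (auto elim: computes.cases)
  next
    case [simp]: (Cons x xs)
    define vs where "vs = map s xs"
    \<comment> \<open>Register \<open>b\<close> holds the accumulated value, \<open>b + 1\<close>
      the number of rounds left and \<open>b + 2\<close> the index of the current round.\<close>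
    define S where "S y k i = s(b := y, b + 1 := k, b + 2 := i)" for y k i
    define body where "body = Seq (Prim (Dec (b + 1))) (Seq (compile g ((b + 2) # b # xs) (b + 3))
           (Seq (clear b) (Seq (move (b + 3) b) (Prim (Inc (b + 2))))))"
    have xs: "x < b" "\<forall>r\<in>set xs. r < b" using PrimRec.prems by auto
    have vs: "map (S y k i) xs = vs" for y k i
      using xs by (auto simp: S_def vs_def)
    have g: "(S y k i, t) \<in> sem (compile g ((b + 2) # b # xs) (b + 3)) \<longleftrightarrow>
      (\<exists>z. computes g (i # y # vs) z \<and> t = (S y k i)(b + 3 := z))" for y k i t
    proof -
      have "\<forall>x\<in>set ((b + 2) # b # xs). x < b + 3"
        using xs by auto
      moreover have "\<forall>r\<ge>b + 3. S y k i r = 0"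
        using PrimRec.prems by (simp add: S_def)
      moreover have "map (S y k i) ((b + 2) # b # xs) = i # y # vs"
        using vs by (simp add: S_def)
      ultimately show ?thesis
        using PrimRec.IH(2)[of "(b + 2) # b # xs" "b + 3" "S y k i" t] by metis
    qed
    have rest: "((S y k i)(b + 3 := z), t) \<in> sem (Seq (clear b) (Seq (move (b + 3) b)
        (Prim (Inc (b + 2))))) \<longleftrightarrow> t = S z k (Suc i)" for y k i z t
    proof -
      let ?s = "(S y k i)(b + 3 := z, b := 0)"
      let ?u = "?s(b + 3 := 0, b := ?s b + ?s (b + 3))"
      have "?u(b + 2 := Suc (?u (b + 2))) = S z k (Suc i)"
        using PrimRec.prems by (auto simp: S_def fun_eq_iff)
      moreover have "b + 3 \<noteq> b" by simp
      ultimately show ?thesis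
        unfolding in_sem_Seq in_sem_Prim isem.simps sem_clear sem_move[OF \<open>b + 3 \<noteq> b\<close>] by metis
    qed
    have dec: "(S y k i, t) \<in> sem (Prim (Dec (b + 1))) \<longleftrightarrow> k > 0 \<and> t = S y (k - 1) i" for y k i t
    proof -
      have "(S y k i)(b + 1 := k - 1) = S y (k - 1) i" "S y k i (b + 1) = k"
        by (auto simp: S_def fun_eq_iff)
      then show ?thesis
        unfolding in_sem_Prim isem.simps by metis
    qed
    have body: "(S y k i, t) \<in> sem body \<longleftrightarrow>
      k > 0 \<and> (\<exists>z. computes g (i # y # vs) z \<and> t = S z (k - 1) (Suc i))" for y k i t
      unfolding body_def in_sem_Seq[of _ _ "Prim (Dec (b + 1))"]
        in_sem_Seq[of _ _ "compile g ((b + 2) # b # xs) (b + 3)"] dec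
      using g rest by (metis (no_types, lifting))
    \<comment> \<open>Rounds left and rounds done always add up to \<open>n\<close>, so an exit with
      \<open>b + 1\<close> zero means that the index has reached \<open>n\<close>.\<close>
    have loop1: "\<exists>y i. i \<le> n \<and> computes (PrimRec f g) (i # vs) y \<and> t = S y (n - i) i"
      if "(S y0 n 0, t) \<in> (sem body)\<^sup>*" "computes f vs y0" for y0 n t
      using that(1)
    proof (induction rule: rtrancl_induct)
      case base
      show ?case
        by (rule exI[of _ y0], rule exI[of _ 0]) (simp add: that(2) computes.PrimRec_0)
    next
      case (step t u)
      then obtain y i where yi: "i \<le> n" "computes (PrimRec f g) (i # vs) y" "t = S y (n - i) i"
        by blast
      with step.hyps(2) obtain z where "n - i > 0" "computes g (i # y # vs) z"
          "u = S z (n - i - 1) (Suc i)"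
        unfolding body yi(3) by blast
      moreover have "n - i - 1 = n - Suc i" by simp
      ultimately show ?case
        using yi by (metis computes.PrimRec_Suc Suc_leI zero_less_diff)
    qed
    have loop2: "\<exists>y0. computes f vs y0 \<and> (S y0 n 0, S y (n - i) i) \<in> (sem body)\<^sup>*"
      if "computes (PrimRec f g) (i # vs) y" "i \<le> n" for y n i
      using that
    proof (induction i arbitrary: y)
      case 0
      then show ?case by (auto elim: computes_PrimRec_0E)
    next
      case (Suc i)
      from Suc.prems(1) obtain y' where y': "computes (PrimRec f g) (i # vs) y'"
          "computes g (i # y' # vs) y"
        by (rule computes_PrimRec_SucE) blast
      from Suc.IH[OF y'(1)] Suc.prems obtain y0 where y0: "computes f vs y0"
          "(S y0 n 0, S y' (n - i) i) \<in> (sem body)\<^sup>*"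
        by auto
      moreover have "(S y' (n - i) i, S y (n - Suc i) (Suc i)) \<in> sem body"
        unfolding body using y' Suc.prems by auto
      ultimately show ?case by (meson rtrancl_into_rtrancl)
    qed
    have f: "(s, u) \<in> sem (compile f xs b) \<longleftrightarrow> (\<exists>y. computes f vs y \<and> u = s(b := y))" for u
      unfolding vs_def using PrimRec.IH(1) PrimRec.prems xs by blast
    have cp: "(s(b := y), u) \<in> sem (copy x (b + 1) (b + 2)) \<longleftrightarrow> u = S y (s x) 0" for y u
    proof -
      have "(s(b := y))(b + 1 := (s(b := y)) (b + 1) + (s(b := y)) x) = S y (s x) 0"
        using PrimRec.prems xs by (auto simp: S_def fun_eq_iff)
      moreover have "(s(b := y)) (b + 2) = 0"
        using PrimRec.prems by simp
      ultimately show ?thesis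
        using xs by (subst sem_copy) simp_all
    qed
    have fin: "(S y k i, t) \<in> sem (Seq (Prim (IsZero (b + 1))) (clear (b + 2))) \<longleftrightarrow>
      k = 0 \<and> t = s(b := y)" for y k i t
    proof -
      have "(S y 0 i)(b + 2 := 0) = s(b := y)" "S y k i (b + 1) = k"
        using PrimRec.prems by (auto simp: S_def fun_eq_iff)
      then show ?thesis
        unfolding in_sem_Seq in_sem_Prim isem.simps sem_clear by metis
    qed
    have "(s, t) \<in> sem (compile (PrimRec f g) args b) \<longleftrightarrow>
      (\<exists>y0. computes f vs y0 \<and> (\<exists>u. (S y0 (s x) 0, u) \<in> (sem body)\<^sup>* \<and>
        (u, t) \<in> sem (Seq (Prim (IsZero (b + 1))) (clear (b + 2)))))"
      unfolding compile.simps Cons list.case body_def[symmetric]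
        in_sem_Seq[of _ _ "compile f xs b"] in_sem_Seq[of _ _ "copy x (b + 1) (b + 2)"]
        in_sem_Seq[of _ _ "Star body"] f sem.simps(3)
      using cp by metis
    also have "\<dots> \<longleftrightarrow> (\<exists>y. computes (PrimRec f g) (s x # vs) y \<and> t = s(b := y))" (is "?L \<longleftrightarrow> ?R")
    proof
      assume ?L
      then obtain y0 u where u: "computes f vs y0" "(S y0 (s x) 0, u) \<in> (sem body)\<^sup>*"
        "(u, t) \<in> sem (Seq (Prim (IsZero (b + 1))) (clear (b + 2)))"
        by blast
      from loop1[OF u(2,1)] obtain y i where "i \<le> s x" "computes (PrimRec f g) (i # vs) y"
        "u = S y (s x - i) i" by blast
      with u(3) fin show ?R by (metis diff_is_0_eq le_antisym)
    next
      assume ?R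
      then obtain y where y: "computes (PrimRec f g) (s x # vs) y" "t = s(b := y)" by blast
      from loop2[OF y(1) order_refl] fin[of y 0 "s x" t] y(2) show ?L by auto
    qed
    finally show ?thesis by (simp only: vs_def Cons list.map)
  qed
next
  case (Mu f)
  define vs where "vs = map s args"
  define S where "S i = s(b := i)" for i
  define body where "body = Seq (compile f (b # args) (b + 1))
         (Seq (Prim (Dec (b + 1))) (Seq (clear (b + 1)) (Prim (Inc b))))"
  have vs: "map (S i) args = vs" for i
    using Mu.prems by (auto simp: S_def vs_def)
  have f: "(S i, t) \<in> sem (compile f (b # args) (b + 1)) \<longleftrightarrow>
      (\<exists>z. computes f (i # vs) z \<and> t = (S i)(b + 1 := z))" for i t
  proof -
    have "\<forall>x\<in>set (b # args). x < b + 1"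
      using Mu.prems by auto
    moreover have "\<forall>r\<ge>b + 1. S i r = 0"
      using Mu.prems by (simp add: S_def)
    moreover have "map (S i) (b # args) = i # vs"
      using vs by (simp add: S_def)
    ultimately show ?thesis
      using Mu.IH[of "b # args" "b + 1" "S i" t] by metis
  qed
  have rest: "((S i)(b + 1 := z), t) \<in> sem (Seq (Prim (Dec (b + 1)))
      (Seq (clear (b + 1)) (Prim (Inc b)))) \<longleftrightarrow> z > 0 \<and> t = S (Suc i)" for i z t
  proof -
    let ?s = "(S i)(b + 1 := z)"
    have "?s(b + 1 := z - 1, b + 1 := 0, b := Suc i) = S (Suc i)"
      using Mu.prems by (auto simp: S_def fun_eq_iff)
    moreover have "?s (b + 1) = z" "(?s(b + 1 := z - 1, b + 1 := 0)) b = i"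
      by (auto simp: S_def)
    ultimately show ?thesis
      unfolding in_sem_Seq in_sem_Prim isem.simps sem_clear by metis
  qed
  have body: "(S i, t) \<in> sem body \<longleftrightarrow> (\<exists>y. computes f (i # vs) (Suc y)) \<and> t = S (Suc i)" for i t
    unfolding body_def in_sem_Seq[of _ _ "compile f (b # args) (b + 1)"]
    using f rest by (metis (no_types, lifting) Suc_pred zero_less_Suc)
  \<comment> \<open>\<open>Dec\<close> lets an iteration pass only on a positive value, and the
    final \<open>IsZero\<close> lets the loop end only on zero: together they are the definition of
    minimisation.\<close>
  have loop1: "\<exists>i. (\<forall>m<i. \<exists>y. computes f (m # vs) (Suc y)) \<and> t = S i"
    if "(S 0, t) \<in> (sem body)\<^sup>*" for t
    using that
  proof (induction rule: rtrancl_induct)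
    case (step t u)
    then show ?case by (metis body less_Suc_eq)
  qed blast
  have loop2: "(S 0, S i) \<in> (sem body)\<^sup>*"
    if "\<forall>m<i. \<exists>y. computes f (m # vs) (Suc y)" for i
    using that
  proof (induction i)
    case (Suc i)
    then have "(S i, S (Suc i)) \<in> sem body" unfolding body by blast
    with Suc show ?case by (meson rtrancl_into_rtrancl less_SucI)
  qed simp
  have fin: "(\<exists>v. (S i, v) \<in> sem (compile f (b # args) (b + 1)) \<and>
      (v, t) \<in> sem (Prim (IsZero (b + 1)))) \<longleftrightarrow> computes f (i # vs) 0 \<and> t = S i" for i t
  proof -
    have "(S i)(b + 1 := 0) = S i"
      using Mu.prems by (auto simp: S_def)
    then show ?thesis
      unfolding f in_sem_Prim isem.simps by (metis fun_upd_same)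
  qed
  have "S 0 = s" using Mu.prems by (auto simp: S_def)
  then have "(s, t) \<in> sem (compile (Mu f) args b) \<longleftrightarrow> (\<exists>u. (S 0, u) \<in> (sem body)\<^sup>* \<and>
      (\<exists>v. (u, v) \<in> sem (compile f (b # args) (b + 1)) \<and> (v, t) \<in> sem (Prim (IsZero (b + 1)))))"
    unfolding compile.simps body_def[symmetric] in_sem_Seq sem.simps(3) by simp
  also have "\<dots> \<longleftrightarrow>
    (\<exists>i. (\<forall>m<i. \<exists>y. computes f (m # vs) (Suc y)) \<and> computes f (i # vs) 0 \<and> t = S i)"
    (is "?L \<longleftrightarrow> ?R")
  proof
    assume ?L
    then obtain u where u: "(S 0, u) \<in> (sem body)\<^sup>*" "\<exists>v. (u, v) \<in> sem (compile f (b # args) (b + 1)) \<and>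
        (v, t) \<in> sem (Prim (IsZero (b + 1)))"
      by blast
    from loop1[OF u(1)] obtain i where "\<forall>m<i. \<exists>y. computes f (m # vs) (Suc y)" "u = S i"
      by blast
    with u(2) fin show ?R by blast
  next
    assume ?R
    then show ?L using loop2 fin by blast
  qed
  also have "\<dots> \<longleftrightarrow> (\<exists>y. computes (Mu f) vs y \<and> t = S y)"
    by (simp only: computes_Mu_iff conj_assoc)
  finally show ?case by (simp only: vs_def S_def)
qed

text \<open>Input and output registers are emptied so that every complete run ends in one known
  state, whose configuration has no tokens left.\<close>

definition halting_cmd :: "recf \<Rightarrow> cmd" where
  "halting_cmd f = Seq (compile f [0] 1) (Seq (clear 0) (clear 1))"

lemma sem_halting_cmd:
  "((\<lambda>_. 0)(0 := n), \<lambda>_. 0) \<in> sem (halting_cmd f) \<longleftrightarrow> (\<exists>y. computes f [n] y)"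
proof -
  let ?s = "(\<lambda>_. 0)(0 := n) :: nat \<Rightarrow> nat"
  have "(?s, t) \<in> sem (compile f [0] 1) \<longleftrightarrow> (\<exists>y. computes f (map ?s [0]) y \<and> t = ?s(1 := y))" for t
    using sem_compile[of "[0]" 1 ?s t f] by fastforce
  then have run: "(?s, t) \<in> sem (compile f [0] 1) \<longleftrightarrow> (\<exists>y. computes f [n] y \<and> t = ?s(1 := y))" for t
    by (simp only: list.map fun_upd_same)
  have zero: "?s(1 := y, 0 := 0, 1 := 0) = (\<lambda>_. 0)" for y
    by (auto simp: fun_eq_iff)
  show ?thesis
    unfolding halting_cmd_def in_sem_Seq sem_clear run
  proof
    assume "\<exists>y. computes f [n] y"
    then obtain y where "computes f [n] y" ..
    then show "\<exists>u. (\<exists>y. computes f [n] y \<and> u = ?s(1 := y)) \<and>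
        (\<exists>v. v = u(0 := 0) \<and> (\<lambda>_. 0) = v(1 := 0))"
      using zero[of y, symmetric] by blast
  qed blast
qed

section \<open>Small-step semantics on lists of commands still to be executed\<close>

inductive kstep :: "cmd list \<Rightarrow> instr \<Rightarrow> cmd list \<Rightarrow> bool" where
  "kstep (Prim q # K) q K"
| "kstep (Seq c d # K) Nop (c # d # K)"
| "kstep (Star c # K) Nop K"
| "kstep (Star c # K) Nop (c # Star c # K)"

inductive_cases kstep_PrimE: "kstep (Prim p # K) q L"
inductive_cases kstep_SeqE: "kstep (Seq c d # K) q L"
inductive_cases kstep_StarE: "kstep (Star c # K) q L"

inductive mstep :: "cmd list \<times> (nat \<Rightarrow> nat) \<Rightarrow> cmd list \<times> (nat \<Rightarrow> nat) \<Rightarrow> bool" where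
  "kstep K q K' \<Longrightarrow> isem q s t \<Longrightarrow> mstep (K, s) (K', t)"

primrec seml :: "cmd list \<Rightarrow> (nat \<Rightarrow> nat) rel" where
  "seml [] = Id"
| "seml (c # K) = sem c O seml K"

lemma in_seml_Cons [simp]: "(s, t) \<in> seml (c # K) \<longleftrightarrow> (\<exists>u. (s, u) \<in> sem c \<and> (u, t) \<in> seml K)"
  by auto

declare seml.simps(2) [simp del]

text \<open>Read backwards: whatever can be achieved after a step could be achieved before it.
  Iterating this from the end of a run gives soundness without cutting the run at loop
  boundaries.\<close>

lemma mstep_seml: "mstep (K, s) (K', s') \<Longrightarrow> (s', t) \<in> seml K' \<Longrightarrow> (s, t) \<in> seml K"
  by (erule mstep.cases, erule kstep.cases) (auto intro: converse_rtrancl_into_rtrancl)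

lemma sem_msteps: "(s, t) \<in> sem c \<Longrightarrow> mstep\<^sup>*\<^sup>* (c # K, s) (K, t)"
proof (induction c arbitrary: s t K)
  case (Prim q)
  then show ?case by (auto intro: mstep.intros kstep.intros)
next
  case (Seq c d)
  then obtain u where "(s, u) \<in> sem c" "(u, t) \<in> sem d" by auto
  then have "mstep\<^sup>*\<^sup>* (c # d # K, s) (K, t)"
    using Seq.IH by (meson rtranclp_trans)
  moreover have "mstep (Seq c d # K, s) (c # d # K, s)"
    by (rule mstep.intros[OF kstep.intros(2)]) simp
  ultimately show ?case by (rule converse_rtranclp_into_rtranclp[rotated])
next
  case (Star c)
  from Star.prems have "(s, t) \<in> (sem c)\<^sup>*" by simp
  then show ?case
  proof (induction rule: converse_rtrancl_induct)
    case base
    have "mstep (Star c # K, t) (K, t)"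
      by (rule mstep.intros[OF kstep.intros(3)]) simp
    then show ?case by blast
  next
    case (step s u)
    have "mstep (Star c # K, s) (c # Star c # K, s)"
      by (rule mstep.intros[OF kstep.intros(4)]) simp
    moreover have "mstep\<^sup>*\<^sup>* (c # Star c # K, s) (Star c # K, u)"
      using Star.IH step.hyps by blast
    ultimately show ?case
      using step.IH by (meson converse_rtranclp_into_rtranclp rtranclp_trans)
  qed
qed

lemma msteps_iff_sem: "mstep\<^sup>*\<^sup>* ([c], s) ([], t) \<longleftrightarrow> (s, t) \<in> sem c"
proof
  have "(snd p, t) \<in> seml (fst p)" if "mstep\<^sup>*\<^sup>* p ([], t)" for p
    using that
    by (induction rule: converse_rtranclp_induct) (auto dest: mstep_seml)
  then show "mstep\<^sup>*\<^sup>* ([c], s) ([], t) \<Longrightarrow> (s, t) \<in> sem c" by fastforce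
qed (rule sem_msteps)

text \<open>The continuations met while \<open>c\<close> runs in front of \<open>K\<close>,
  comparable to the partial derivatives of a regular expression. There are finitely many, since each
  unfolding of a loop returns to \<open>Star c # K\<close>; this makes the alphabet finite.\<close>

primrec conts :: "cmd \<Rightarrow> cmd list \<Rightarrow> cmd list set" where
  "conts (Prim q) K = {Prim q # K}"
| "conts (Seq c d) K = insert (Seq c d # K) (conts c (d # K) \<union> conts d K)"
| "conts (Star c) K = insert (Star c # K) (conts c (Star c # K))"

lemma finite_conts: "finite (conts c K)"
  by (induction c arbitrary: K) auto

lemma Cons_in_conts: "c # K \<in> conts c K"
  by (cases c) auto

lemma kstep_conts: "L \<in> conts c K \<Longrightarrow> kstep L q L' \<Longrightarrow> L' \<in> insert K (conts c K)"
proof (induction c arbitrary: K)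
  case (Prim p)
  then show ?case by (auto elim: kstep_PrimE)
next
  case (Seq c d)
  from Seq.prems(1) consider "L = Seq c d # K" | "L \<in> conts c (d # K)" | "L \<in> conts d K"
    by auto
  then show ?case
  proof cases
    case 1
    with Seq.prems(2) show ?thesis
      by (auto elim: kstep_SeqE simp: Cons_in_conts)
  next
    case 2
    with Seq.IH(1) Seq.prems(2) show ?thesis
      using Cons_in_conts by fastforce
  next
    case 3
    with Seq.IH(2) Seq.prems(2) show ?thesis by fastforce
  qed
next
  case (Star c)
  from Star.prems(1) consider "L = Star c # K" | "L \<in> conts c (Star c # K)"
    by auto
  then show ?case
  proof cases
    case 1
    with Star.prems(2) show ?thesis
      by (auto elim: kstep_StarE simp: Cons_in_conts)
  next
    case 2
    with Star.IH Star.prems(2) show ?thesis by fastforce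
  qed
qed

section \<open>Rules that act on the top of a stack\<close>

text \<open>The table entry is the number of letters that survive: 0 pops, 1 drops the letter just
  read, and 2 deletes only its marker, which amounts to a push.\<close>

definition pair_rules :: "'a \<Rightarrow> ('a \<Rightarrow> 'a \<Rightarrow> nat option) \<Rightarrow> 'a srs" where
  "pair_rules m A = {([x, y, m], take k [x, y]) | x y k. A x y = Some k}"

text \<open>This rules out overlaps of left-hand sides, and it makes a marker that has failed to act
  stay on the stack for good.\<close>

definition unmarked :: "'a \<Rightarrow> ('a \<Rightarrow> 'a \<Rightarrow> nat option) \<Rightarrow> bool" where
  "unmarked m A \<longleftrightarrow> (\<forall>x. A x m = None \<and> A m x = None)"

text \<open>The stack is kept with its top first, so it is the reversal of the string it stands for.\<close>

fun stp :: "'a \<Rightarrow> ('a \<Rightarrow> 'a \<Rightarrow> nat option) \<Rightarrow> 'a list \<Rightarrow> 'a \<Rightarrow> 'a list" where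
  "stp m A (y # x # st) z =
     (if z = m then case A x y of None \<Rightarrow> z # y # x # st | Some k \<Rightarrow> rev (take k [x, y]) @ st
      else z # y # x # st)"
| "stp m A st z = z # st"

abbreviation run :: "'a \<Rightarrow> ('a \<Rightarrow> 'a \<Rightarrow> nat option) \<Rightarrow> 'a list \<Rightarrow> 'a list \<Rightarrow> 'a list" where
  "run m A \<equiv> foldl (stp m A)"

lemma stp_push: "z \<noteq> m \<Longrightarrow> stp m A st z = z # st"
  by (cases "(m, A, st, z)" rule: stp.cases) auto

lemma run_push: "m \<notin> set w \<Longrightarrow> run m A st w = rev w @ st"
  by (induction w arbitrary: st) (auto simp: stp_push)

text \<open>The two letters are pushed unconditionally, so nothing below them can interfere when the
  marker arrives.\<close>

lemma run_rule:
  assumes "unmarked m A" "A x y = Some k"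
  shows "run m A st [x, y, m] = run m A st (take k [x, y])"
proof -
  have "x \<noteq> m" "y \<noteq> m" using assms by (auto simp: unmarked_def)
  moreover have "m \<notin> set (take k [x, y])"
    using calculation by (auto dest: in_set_takeD)
  ultimately show ?thesis
    using assms(2) by (simp add: stp_push run_push)
qed

lemma run_reduces:
  assumes "unmarked m A" "reduces \<Sigma> (pair_rules m A) u v"
  shows "run m A st u = run m A st v"
proof -
  from assms(2) obtain x y k p q where "A x y = Some k"
    "u = p @ [x, y, m] @ q" "v = p @ take k [x, y] @ q"
    unfolding reduces_def pair_rules_def by blast
  then show ?thesis
    by (simp only: foldl_append run_rule[OF assms(1)])
qed

lemma run_equiv:
  assumes "unmarked m A" "srs_equiv \<Sigma> (pair_rules m A) u v"
  shows "run m A st u = run m A st v"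
  using assms(2) unfolding srs_equiv_def
  by (induction rule: equivclp_induct) (metis run_reduces[OF assms(1)])+

section \<open>Normal forms, termination and convergence\<close>

lemma reduces_append:
  assumes "reduces \<Sigma> S u v" "w \<in> lists \<Sigma>"
  shows "reduces \<Sigma> S (u @ w) (v @ w)"
  using assms unfolding reduces_def by (metis append.assoc append_in_lists_conv)

lemma reduces_star_append:
  assumes "(reduces \<Sigma> S)\<^sup>*\<^sup>* u v" "w \<in> lists \<Sigma>"
  shows "(reduces \<Sigma> S)\<^sup>*\<^sup>* (u @ w) (v @ w)"
  using assms(1)
proof (induction rule: rtranclp_induct)
  case (step v v')
  then show ?case
    using reduces_append[OF step.hyps(2) assms(2)] by (meson rtranclp.rtrancl_into_rtrancl)
qed simp

lemma stp_cases:
  "stp m A st z = z # st \<or> (\<exists>x y k st'. st = y # x # st' \<and> A x y = Some k \<and> z = m \<and>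
     stp m A st z = rev (take k [x, y]) @ st')"
  by (cases "(m, A, st, z)" rule: stp.cases) (auto split: option.splits)

lemma stp_in_lists: "st \<in> lists \<Sigma> \<Longrightarrow> z \<in> \<Sigma> \<Longrightarrow> stp m A st z \<in> lists \<Sigma>"
  using stp_cases[of m A st z] by (auto dest!: in_set_takeD)

text \<open>Every move of the stack is either no step or one rewriting step at the end of the prefix
  read so far. Together with \<open>run_reduces\<close>, the stack becomes a canonical
  representative of the equivalence class.\<close>

lemma reduces_star_run:
  assumes "u \<in> lists \<Sigma>"
  shows "(reduces \<Sigma> (pair_rules m A))\<^sup>*\<^sup>* u (rev (run m A [] u)) \<and> run m A [] u \<in> lists \<Sigma>"
  using assms
proof (induction u rule: rev_induct)
  case (snoc z u)
  let ?st = "run m A [] u"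
  have st: "?st \<in> lists \<Sigma>" and z: "z \<in> \<Sigma>" using snoc by auto
  have "(reduces \<Sigma> (pair_rules m A))\<^sup>*\<^sup>* (u @ [z]) (rev ?st @ [z])"
    using snoc by (intro reduces_star_append) auto
  moreover have "(reduces \<Sigma> (pair_rules m A))\<^sup>*\<^sup>* (rev ?st @ [z]) (rev (stp m A ?st z))"
  proof (cases "stp m A ?st z = z # ?st")
    case False
    then obtain x y k st' where 2: "?st = y # x # st'" "A x y = Some k" "z = m"
        "stp m A ?st z = rev (take k [x, y]) @ st'"
      using stp_cases[of m A ?st z] by blast
    have "reduces \<Sigma> (pair_rules m A) (rev ?st @ [z]) (rev (stp m A ?st z))"
      unfolding reduces_def pair_rules_def
      using 2 st by (intro exI[of _ "[x, y, m]"] exI[of _ "take k [x, y]"] exI[of _ "rev st'"]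
          exI[of _ "[]"]) auto
    then show ?thesis by blast
  qed simp
  ultimately show ?case
    using stp_in_lists[OF st z] by auto
qed auto

lemma reduces_in_lists: "srs_over \<Sigma> S \<Longrightarrow> reduces \<Sigma> S u v \<Longrightarrow> u \<in> lists \<Sigma> \<and> v \<in> lists \<Sigma>"
  unfolding srs_over_def reduces_def by force

lemma terminating_pair_rules: "terminating \<Sigma> (pair_rules m A)"
proof -
  have "length v < length u" if "reduces \<Sigma> (pair_rules m A) u v" for u v
    using that unfolding reduces_def pair_rules_def by auto
  then have less: "\<And>i. length (u (Suc i)) < length (u i)"
    if "\<forall>i. reduces \<Sigma> (pair_rules m A) (u i) (u (Suc i))" for u
    using that by blast
  have "\<not> (\<forall>i. reduces \<Sigma> (pair_rules m A) (u i) (u (Suc i)))" for u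
    using less[of u] wf_no_infinite_down_chainE[of less_than "\<lambda>i. length (u i)"]
    by (metis less_than_iff wf_less_than)
  then show ?thesis
    unfolding terminating_def by blast
qed

lemma convergent_pair_rules:
  assumes "unmarked m A" "srs_over \<Sigma> (pair_rules m A)"
  shows "convergent \<Sigma> (pair_rules m A)"
proof -
  let ?R = "reduces \<Sigma> (pair_rules m A)"
  have run: "run m A [] u = run m A [] v" if "?R\<^sup>*\<^sup>* u v" for u v
    using that by (induction rule: rtranclp_induct) (auto dest: run_reduces[OF assms(1)])
  have lists: "v \<in> lists \<Sigma>" if "?R\<^sup>*\<^sup>* u v" "u \<in> lists \<Sigma>" for u v
    using that by (induction rule: rtranclp_induct) (auto dest: reduces_in_lists[OF assms(2)])
  have "\<exists>u. ?R\<^sup>*\<^sup>* s1 u \<and> ?R\<^sup>*\<^sup>* s2 u" if "?R\<^sup>*\<^sup>* t s1" "?R\<^sup>*\<^sup>* t s2" for t s1 s2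
  proof (cases "t \<in> lists \<Sigma>")
    case True
    then show ?thesis
      using that run lists reduces_star_run by metis
  next
    \<comment> \<open>A string with a letter outside the alphabet admits no step at all.\<close>
    case False
    then have "\<not> ?R t u" for u
      using reduces_in_lists[OF assms(2)] by blast
    then have "s1 = t" using that(1) by (metis converse_rtranclpE)
    then show ?thesis using that(2) by blast
  qed
  then have "confluentp ?R"
    by (auto intro!: confluentpI)
  then show ?thesis
    unfolding convergent_def using terminating_pair_rules[of \<Sigma> m A] by blast
qed

lemma dwindling_pair_rules: "dwindling (pair_rules m A)"
proof -
  have "strict_prefix (take k [x, y]) [x, y, m]" for k and x y :: 'a
    by (auto simp: strict_prefix_def take_Cons' prefix_def)
  then show ?thesis
    unfolding dwindling_def pair_rules_def by blast
qed

lemma srs_equiv_pair_rules_iff: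
  assumes "unmarked m A" "u \<in> lists \<Sigma>" "v \<in> lists \<Sigma>"
  shows "srs_equiv \<Sigma> (pair_rules m A) u v \<longleftrightarrow> run m A [] u = run m A [] v"
proof
  let ?R = "reduces \<Sigma> (pair_rules m A)"
  assume "run m A [] u = run m A [] v"
  then have "?R\<^sup>*\<^sup>* u (rev (run m A [] u))" "?R\<^sup>*\<^sup>* v (rev (run m A [] u))"
    using reduces_star_run assms by metis+
  then show "srs_equiv \<Sigma> (pair_rules m A) u v"
    unfolding srs_equiv_def
    by (meson equivclp_sym equivclp_trans rtranclp_into_equivclp)
qed (rule run_equiv[OF assms(1)])

lemma run_map:
  assumes "inj h" "\<And>x y. B (h x) (h y) = A x y"
  shows "run (h m) B (map h st) (map h w) = map h (run m A st w)"
proof -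
  have "rev (take k [h x, h y]) = map h (rev (take k [x, y]))" for k x y
    by (simp add: take_map[of k h "[x, y]", simplified] rev_map)
  then have "stp (h m) B (map h st) (h z) = map h (stp m A st z)" for st z
    by (cases "(m, A, st, z)" rule: stp.cases)
      (simp_all add: assms(2) inj_eq[OF assms(1)] split: option.splits)
  then show ?thesis
    by (induction w arbitrary: st) auto
qed

text \<open>
  Two runs whose stacks have a common upper part \<open>X\<close> act alike as long as \<open>X\<close> has two elements. Once
  a marker is stuck on one lower part only, that lower part keeps more markers than the other one.
\<close>

lemma merge_sound:
  assumes unmarked: "unmarked m A"
    and distinct: "\<And>P Q. good P Q \<Longrightarrow> P \<noteq> Q"
    and nonempty: "\<And>P Q. good P Q \<Longrightarrow> P \<noteq> [] \<and> Q \<noteq> []"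
    and no_marker: "\<And>P Q. good P Q \<Longrightarrow> m \<notin> set P \<and> m \<notin> set Q"
    and letter: "\<And>x P y Q z k l. good (x # P) (y # Q) \<Longrightarrow> A x z = Some k \<Longrightarrow> A y z = Some l \<Longrightarrow>
      good (rev (take k [x, z]) @ P) (rev (take l [y, z]) @ Q) \<or> accept"
    and quiet: "\<And>P Q. good P Q \<Longrightarrow> stp m A P m \<in> {P, m # P} \<and> stp m A Q m \<in> {Q, m # Q}"
    and start: "good P Q" and eq: "run m A P w = run m A Q w"
  shows accept
proof -
  \<comment> \<open>Markers are counted because \<open>Q\<close> may get stuck later as well: a
    further marker that reaches below the common part adds one to \<open>P\<close> and at most one
    to \<open>Q\<close>, so the gap persists.\<close>
  define dead where "dead P Q \<longleftrightarrow> P \<noteq> [] \<and> hd P = m \<and> count_list Q m < count_list P m" for P Q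
  have stp_m: "stp m A (m # P) m = m # m # P" "stp m A (y # m # P) m = m # y # m # P" for y P
    using unmarked by (cases P; simp add: unmarked_def)+
  have count: "count_list (stp m A Q m) m \<le> Suc (count_list Q m)" for Q
  proof (cases "stp m A Q m = m # Q")
    case False
    then obtain x y k st' where Q: "Q = y # x # st'" "A x y = Some k"
        "stp m A Q m = rev (take k [x, y]) @ st'"
      using stp_cases[of m A Q m] by blast
    then have "x \<noteq> m" "y \<noteq> m" using unmarked by (auto simp: unmarked_def)
    then have "m \<notin> set (take k [x, y])" by (auto dest: in_set_takeD)
    with Q show ?thesis by (simp add: count_list_0_iff[THEN iffD2])
  qed simp
  have dead_step: "\<exists>X' P' Q'. stp m A (X @ P) z = X' @ P' \<and> stp m A (X @ Q) z = X' @ Q' \<and> dead P' Q'"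
    if "dead P Q" for X P Q z
  proof (cases "z = m")
    case False
    have "stp m A (X @ P) z = (z # X) @ P" "stp m A (X @ Q) z = (z # X) @ Q"
      using False by (simp_all add: stp_push)
    with that show ?thesis by blast
  next
    case [simp]: True
    from that obtain P0 where P: "P = m # P0" and less: "count_list Q m < count_list P m"
      by (cases P) (auto simp: dead_def)
    consider "X = []" | y where "X = [y]" | y x X' where "X = y # x # X'"
      by (metis neq_Nil_conv)
    then show ?thesis
    proof cases
      case 1
      have "dead (m # P) (stp m A Q m)"
        using count[of Q] less by (simp add: dead_def)
      moreover have "stp m A (X @ P) z = [] @ m # P"
        using stp_m P 1 by simp
      ultimately show ?thesis using 1 by fastforce
    next
      case (2 y)
      have "count_list (stp m A (y # Q) m) m \<le> Suc (count_list (y # Q) m)"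
        using count by blast
      then have "dead (m # y # P) (stp m A (y # Q) m)"
        using less by (auto simp: dead_def)
      moreover have "stp m A (X @ P) z = [] @ m # y # P"
        using stp_m P 2 by simp
      ultimately show ?thesis using 2 by fastforce
    next
      case (3 y x X')
      have "\<exists>X''. \<forall>R. stp m A (X @ R) z = X'' @ R"
        using 3 by (cases "A x y") auto
      with that show ?thesis by blast
    qed
  qed
  define ok where "ok p q \<longleftrightarrow>
    (\<exists>X P Q. p = X @ P \<and> q = X @ Q \<and> (good P Q \<or> dead P Q \<or> dead Q P))" for p q
  have okI: "ok (X @ P) (X @ Q)" if "good P Q \<or> dead P Q \<or> dead Q P" for X P Q
    using that unfolding ok_def by blast
  note ok0 = okI[of _ _ "[]", unfolded append_Nil]
  have step: "ok (stp m A p z) (stp m A q z) \<or> accept" if ok: "ok p q" for p q z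
  proof -
    from ok obtain X P Q where pq: "p = X @ P" "q = X @ Q" and "good P Q \<or> dead P Q \<or> dead Q P"
      by (auto simp: ok_def)
    from this(3) show ?thesis
    proof (elim disjE)
      assume "dead P Q"
      then obtain X' P' Q' where "stp m A p z = X' @ P'" "stp m A q z = X' @ Q'" "dead P' Q'"
        using dead_step pq by blast
      then show ?thesis using okI[of P' Q' X'] by simp
    next
      assume "dead Q P"
      then obtain X' P' Q' where "stp m A q z = X' @ P'" "stp m A p z = X' @ Q'" "dead P' Q'"
        using dead_step pq by blast
      then show ?thesis using okI[of Q' P' X'] by simp
    next
      assume good: "good P Q"
      show ?thesis
      proof (cases "z = m")
        case False
        have "stp m A p z = (z # X) @ P" "stp m A q z = (z # X) @ Q"
          using False pq by (simp_all add: stp_push)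
        with good show ?thesis using okI[of P Q "z # X"] by simp
      next
        case [simp]: True
        have count0: "count_list P m = 0" "count_list Q m = 0"
          using no_marker[OF good] by (simp_all add: count_list_0_iff)
        from nonempty[OF good] obtain x P0 y Q0 where PQ: "P = x # P0" "Q = y # Q0"
          by (meson list.exhaust)
        consider "X = []" | z where "X = [z]" | y x X' where "X = y # x # X'"
          by (metis neq_Nil_conv)
        then show ?thesis
        proof cases
          \<comment> \<open>A marker with no letter before it vanishes or sticks, on each side
            separately; if it sticks on one side only, that side is dead.\<close>
          case 1
          have "ok P Q" "ok (m # P) (m # Q)"
            using ok0[of P Q] okI[of P Q "[m]"] good by simp_all
          moreover have "dead (m # P) Q" "dead (m # Q) P"
            unfolding dead_def using count0 by simp_all
          then have "ok (m # P) Q" "ok P (m # Q)"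
            using ok0 by blast+
          ultimately show ?thesis
            using quiet[OF good] pq 1 by auto
        next
          \<comment> \<open>The letter \<open>u\<close> just read meets two different stack tops:
            the only case in which the simulation advances.\<close>
          case (2 u)
          have p: "stp m A p z = (case A x u of None \<Rightarrow> [m, u] @ P | Some k \<Rightarrow> rev (take k [x, u]) @ P0)"
            and q: "stp m A q z = (case A y u of None \<Rightarrow> [m, u] @ Q | Some k \<Rightarrow> rev (take k [y, u]) @ Q0)"
            unfolding PQ using pq 2 PQ by (simp_all split: option.split)
          have set: "m \<notin> set (rev (take k [x, u]) @ P0)" if "A x u = Some k" for k
            using no_marker[OF good] PQ that unmarked by (auto simp: unmarked_def dest!: in_set_takeD)
          have set': "m \<notin> set (rev (take k [y, u]) @ Q0)" if "A y u = Some k" for k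
            using no_marker[OF good] PQ that unmarked by (auto simp: unmarked_def dest!: in_set_takeD)
          show ?thesis
          proof (cases "A x u")
            case x: None
            show ?thesis
            proof (cases "A y u")
              case None
              with x p q have "stp m A p z = [m, u] @ P" "stp m A q z = [m, u] @ Q"
                by simp_all
              with good show ?thesis using okI[of P Q "[m, u]"] by simp
            next
              case (Some k)
              then have "dead (stp m A p z) (stp m A q z)"
                using p q x set'[OF Some] by (simp add: dead_def count_list_0_iff[THEN iffD2] del: count_list_append)
              then show ?thesis using ok0 by blast
            qed
          next
            case x: (Some k)
            show ?thesis
            proof (cases "A y u")
              case None
              then have "dead (stp m A q z) (stp m A p z)"
                using p q x set[OF x] by (simp add: dead_def count_list_0_iff[THEN iffD2] del: count_list_append)
              then show ?thesis using ok0 by blast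
            next
              case (Some l)
              from letter[OF good[unfolded PQ] x Some] show ?thesis
                using p q x Some ok0 by auto
            qed
          qed
        next
          case (3 y x X')
          have "\<exists>X''. \<forall>R. stp m A (X @ R) z = X'' @ R"
            using 3 by (cases "A x y") auto
          then obtain X'' where "stp m A p z = X'' @ P" "stp m A q z = X'' @ Q"
            using pq by blast
          with good show ?thesis using okI[of P Q X''] by simp
        qed
      qed
    qed
  qed
  have steps: "ok (run m A p w) (run m A q w) \<or> accept" if "ok p q" for p q
    using that
  proof (induction w arbitrary: p q)
    case (Cons z w)
    from step[OF Cons.prems, of z] show ?case
    proof
      assume "ok (stp m A p z) (stp m A q z)"
      from Cons.IH[OF this] show ?thesis by simp
    qed simp
  qed simp
  have "good P Q \<or> dead P Q \<or> dead Q P"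
    using start by simp
  then have "ok P Q"
    unfolding ok_def by (intro exI[of _ "[]"] exI[of _ P] exI[of _ Q]) simp
  from steps[OF this] show accept
  proof
    assume "ok (run m A P w) (run m A Q w)"
    then have "\<exists>P'. good P' P' \<or> dead P' P'"
      unfolding eq ok_def by auto
    then show accept
      using distinct by (auto simp: dead_def)
  qed
qed

section \<open>Soundness of the simulation\<close>

text \<open>A configuration is \<open>St K\<close> followed by the registers in unary, with one
  \<open>Tok r\<close> for each unit of register \<open>r\<close>. The order of tokens carries no
  meaning and pads are blanks, so an instruction changes at most one letter besides the state
  letter.\<close>

datatype letter = Pad | Tok nat | St "cmd list"

primrec is_St :: "letter \<Rightarrow> bool" where
  "is_St Pad = False"
| "is_St (Tok r) = False"
| "is_St (St K) = True"

text \<open>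
  \<open>Mk\<close> marks the letter before it as freshly read; a symbol without marker has been pushed.
  Letters and labels carry a colour, which alternates between successive configurations, so that the
  next configuration cannot be read before all of the current one has been popped.
  A label \<open>Lb c q a b q'\<close> rewrites the letter \<open>a\<close> of colour \<open>c\<close> to \<open>b\<close> of the other colour and takes a
  transducer, whose states record the instruction executed so far, from \<open>q\<close> to \<open>q'\<close>.
\<close>

datatype sym =
    Bot
  | Mk
  | Init
  | Lt bool letter
  | Lb bool instr letter letter instr
  | Fin bool letter

definition lab :: "instr \<Rightarrow> letter \<Rightarrow> letter \<Rightarrow> instr \<Rightarrow> bool" where
  "lab q a b q' \<longleftrightarrow>
     \<not> is_St a \<and> b = a \<and> q' = q \<and> (\<forall>r. q = IsZero r \<longrightarrow> a \<noteq> Tok r) \<or>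
     (\<exists>r. q = Nop \<and> a = Pad \<and> b = Tok r \<and> q' = Inc r) \<or>
     (\<exists>r. q = Nop \<and> a = Tok r \<and> b = Pad \<and> q' = Dec r) \<or>
     (\<exists>K K'. a = St K \<and> b = St K' \<and> q' = q \<and> kstep K q K')"

definition initial :: "instr \<Rightarrow> bool" where
  "initial q \<longleftrightarrow> q = Nop \<or> (\<exists>r. q = IsZero r)"

text \<open>The first symbol is the stack top, the second has just been read. \<open>Bot\<close>
  swallows \<open>Lt c Pad\<close> and \<open>Fin c a\<close>, so that the other stack can grow by a
  pad or be emptied on its own.\<close>

fun act :: "cmd list \<Rightarrow> sym \<Rightarrow> sym \<Rightarrow> nat option" where
  "act K0 Bot (Lt c a) =
     (case a of Pad \<Rightarrow> Some 1 | Tok r \<Rightarrow> None | St K \<Rightarrow> Some 2)"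
| "act K0 Bot (Lb c q a b q') = (if initial q \<and> lab q a b q' then Some 2 else None)"
| "act K0 Bot (Fin c a) = Some 1"
| "act K0 (Lt c a) (Lt c' b) = (if c' = c \<and> \<not> is_St b then Some 2 else None)"
| "act K0 (Lt c a) (Lb c' q a' b q') = (if c' = c \<and> a' = a then Some 0 else None)"
| "act K0 (Lt c a) (Fin c' a') =
     (if c' = c \<and> a' = a \<and> (a = Pad \<or> a = St []) then Some 0 else None)"
| "act K0 (Lb c p a b q) (Lt c' b') = (if c' = (\<not> c) \<and> b' = b then Some 0 else None)"
| "act K0 (Lb c p a b q) (Lb c' q' a' b' q'') =
     (if c' = c \<and> q' = q \<and> \<not> is_St b \<and> lab q' a' b' q'' then Some 2 else None)"
| "act K0 Init (Lt c a) = (if c \<and> a = St K0 then Some 0 else None)"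
| "act K0 _ _ = None"

text \<open>The letter that pops a symbol of the right stack; \<open>Bot\<close> is a dummy value,
  different from every letter, for symbols popped by none.\<close>

fun out :: "cmd list \<Rightarrow> sym \<Rightarrow> sym" where
  "out K0 Init = Lt True (St K0)"
| "out K0 (Lb c p a b q) = Lt (\<not> c) b"
| "out K0 _ = Bot"

section \<open>Register contents of a word and runs of the label transducer\<close>

definition cnt :: "letter list \<Rightarrow> nat \<Rightarrow> nat" where
  "cnt w r = count_list w (Tok r)"

lemma cnt_Nil [simp]: "cnt [] = (\<lambda>_. 0)"
  by (simp add: cnt_def fun_eq_iff)

lemma cnt_append [simp]: "cnt (v @ w) = (\<lambda>r. cnt v r + cnt w r)"
  by (simp add: cnt_def fun_eq_iff)

lemma cnt_Cons [simp]:
  "cnt (Pad # w) = cnt w"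
  "cnt (St K # w) = cnt w"
  "cnt (Tok r # w) = (cnt w)(r := Suc (cnt w r))"
  by (auto simp: cnt_def fun_eq_iff)

text \<open>Labels are listed with the top of the stack, that is the last label read, first.\<close>

inductive labrun :: "bool \<Rightarrow> letter list \<Rightarrow> letter list \<Rightarrow> instr \<Rightarrow> sym list \<Rightarrow> bool" for c where
  Nil: "initial q \<Longrightarrow> labrun c [] [] q []"
| Cons: "labrun c v v' p J \<Longrightarrow> \<forall>b\<in>set v'. \<not> is_St b \<Longrightarrow> lab p a b q \<Longrightarrow>
    labrun c (a # v) (b # v') q (Lb c p a b q # J)"

lemma labrun_out: "labrun c v v' q J \<Longrightarrow> map (out K0) J = map (Lt (\<not> c)) v'"
  by (induction rule: labrun.induct) auto

text \<open>A change is made from \<open>Nop\<close> only, where the counts still agree. Copying a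
  letter preserves every relation \<open>isem q\<close>, because \<open>IsZero r\<close> refuses to
  copy \<open>Tok r\<close>.\<close>

lemma labrun_isem: "labrun c v v' q J \<Longrightarrow> \<forall>a\<in>set v. \<not> is_St a \<Longrightarrow> isem q (cnt v) (cnt v')"
proof (induction rule: labrun.induct)
  case (Nil q)
  then show ?case by (auto simp: initial_def)
next
  case (Cons v v' p J a b q)
  then have "isem p (cnt v) (cnt v')" "\<not> is_St a" by auto
  with \<open>lab p a b q\<close> show ?case
    by (cases a; cases p) (auto simp: lab_def fun_eq_iff)
qed

section \<open>The invariant linking the two stacks\<close>

definition rcfg :: "cmd list \<Rightarrow> (nat \<Rightarrow> nat) \<Rightarrow> cmd list \<Rightarrow> letter list \<Rightarrow> bool" where
  "rcfg K0 s0 K w \<longleftrightarrow> (\<forall>a\<in>set w. \<not> is_St a) \<and> mstep\<^sup>*\<^sup>* (K0, s0) (K, cnt w)"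

text \<open>In \<open>copying\<close>, \<open>u\<close> has been read to the left stack and
  \<open>J\<close> on the right still awaits \<open>v\<close>. In \<open>labelling\<close>, the
  labels \<open>J\<close> have consumed the suffix \<open>v\<close>, and their outputs
  \<open>v'\<close> will end the next configuration. Borderline cases belong to
  \<open>copying\<close>: with \<open>J = []\<close> no label has been read, and with
  \<open>u = []\<close> the next configuration has taken over.\<close>

inductive good :: "cmd list \<Rightarrow> (nat \<Rightarrow> nat) \<Rightarrow> sym list \<Rightarrow> sym list \<Rightarrow> bool" for K0 s0 where
  copying: "rcfg K0 s0 K w \<Longrightarrow> St K # w = u @ v \<Longrightarrow> map (out K0) J = map (Lt c) v \<Longrightarrow>
    good K0 s0 (map (Lt c) (rev u) @ [Bot]) (J @ [Bot])"
| labelling: "rcfg K0 s0 K w \<Longrightarrow> St K # w = u @ v \<Longrightarrow> u \<noteq> [] \<Longrightarrow> J \<noteq> [] \<Longrightarrow> labrun c v v' q J \<Longrightarrow>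
    good K0 s0 (map (Lt c) (rev u) @ [Bot]) (J @ [Bot])"

lemma out_eq_Lt:
  "out K0 j = Lt c b \<longleftrightarrow> j = Init \<and> c \<and> b = St K0 \<or> (\<exists>p a q. j = Lb (\<not> c) p a b q)"
  by (cases j) auto

lemma map_out_sym:
  "map (out K0) J = map (Lt c) v \<Longrightarrow> j \<in> set J \<Longrightarrow> j = Init \<or> (\<exists>c p a b q. j = Lb c p a b q)"
proof -
  assume "map (out K0) J = map (Lt c) v" "j \<in> set J"
  then have "out K0 j \<in> Lt c ` set v" by (metis image_eqI list.set_map)
  then show ?thesis by (auto simp: out_eq_Lt)
qed

lemma good_stacks:
  assumes "good K0 s0 P Q"
  obtains c u J where "P = map (Lt c) (rev u) @ [Bot]" "Q = J @ [Bot]"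
    "\<forall>j\<in>set J. j = Init \<or> (\<exists>c p a b q. j = Lb c p a b q)" "u \<noteq> [] \<or> J \<noteq> []"
    "\<And>a u'. u = a # u' \<Longrightarrow> is_St a"
  using assms
proof cases
  case (copying K w u v J c)
  then show ?thesis
    using that[of c u J] map_out_sym[OF copying(5)] by (fastforce simp: Cons_eq_append_conv)
next
  case (labelling K w u v J c v' q)
  have "j \<in> set J \<Longrightarrow> j = Init \<or> (\<exists>c p a b q. j = Lb c p a b q)" for j
    using map_out_sym[OF labrun_out[OF labelling(7)]] by blast
  with labelling show ?thesis
    using that[of c u J] by (fastforce simp: Cons_eq_append_conv)
qed

text \<open>Above \<open>Bot\<close> the first stack has only letters and the second has none, and
  at least one of them is longer than \<open>[Bot]\<close>.\<close>

lemma good_distinct: "good K0 s0 P Q \<Longrightarrow> P \<noteq> Q"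
proof
  assume "good K0 s0 P Q" "P = Q"
  then obtain c u J where "map (Lt c) (rev u) = J"
    "\<forall>j\<in>set J. j = Init \<or> (\<exists>c p a b q. j = Lb c p a b q)" "u \<noteq> [] \<or> J \<noteq> []"
    by (elim good_stacks) auto
  then show False
    by (cases u rule: rev_cases) auto
qed

lemma good_nonempty: "good K0 s0 P Q \<Longrightarrow> P \<noteq> [] \<and> Q \<noteq> []"
  by (elim good_stacks) auto

lemma good_no_marker: "good K0 s0 P Q \<Longrightarrow> Mk \<notin> set P \<and> Mk \<notin> set Q"
  by (elim good_stacks) fastforce

text \<open>Soundness uses only that each entry present agrees with \<open>act\<close>, so it
  applies to every finite restriction of that infinite table.\<close>

locale table =
  fixes K0 :: "cmd list" and A :: "sym \<Rightarrow> sym \<Rightarrow> nat option"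
  assumes sub: "A x y = Some k \<Longrightarrow> act K0 x y = Some k"
begin

lemma unmarked: "unmarked Mk A"
proof -
  have "A x Mk = None" "A Mk x = None" for x
    using sub[of x Mk] sub[of Mk x] by (cases x; cases "A x Mk"; cases "A Mk x"; auto)+
  then show ?thesis by (simp add: unmarked_def)
qed

text \<open>A marker without a fresh letter could do harm only through an entry 0 or 1. No such pair
  is adjacent on these stacks: letters and labels are not mixed, and no pad lies directly on
  \<open>Bot\<close>, as a configuration starts with its state letter.\<close>

lemma good_quiet:
  assumes "good K0 s0 P Q"
  shows "stp Mk A P Mk \<in> {P, Mk # P} \<and> stp Mk A Q Mk \<in> {Q, Mk # Q}"
proof -
  have quiet: "stp Mk A (y # x # st) Mk \<in> {y # x # st, Mk # y # x # st}"
    if "act K0 x y \<in> {None, Some 2}" for x y st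
    using that sub[of x y] by (cases "A x y") auto
  from assms obtain c u J where *: "P = map (Lt c) (rev u) @ [Bot]" "Q = J @ [Bot]"
    "\<forall>j\<in>set J. j = Init \<or> (\<exists>c p a b q. j = Lb c p a b q)"
    "\<And>a u'. u = a # u' \<Longrightarrow> is_St a"
    by (elim good_stacks) blast
  have "stp Mk A P Mk \<in> {P, Mk # P}"
  proof (cases u rule: rev_cases)
    case Nil
    then show ?thesis using * by simp
  next
    case (snoc u1 y)
    show ?thesis
    proof (cases u1 rule: rev_cases)
      case Nil
      then have "is_St y" using *(4) snoc by simp
      then have "act K0 Bot (Lt c y) \<in> {None, Some 2}" by (cases y) auto
      then show ?thesis using quiet snoc Nil * by simp
    next
      case (snoc u2 x)
      have "act K0 (Lt c x) (Lt c y) \<in> {None, Some 2}" by auto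
      then show ?thesis using quiet snoc \<open>u = u1 @ [y]\<close> * by simp
    qed
  qed
  moreover have "stp Mk A Q Mk \<in> {Q, Mk # Q}"
  proof (cases J)
    case Nil
    then show ?thesis using * by simp
  next
    case (Cons y J1)
    show ?thesis
    proof (cases J1)
      case Nil
      have "act K0 Bot y \<in> {None, Some 2}" using *(3) Cons by auto
      then show ?thesis using quiet Cons Nil * by simp
    next
      case (Cons x J2)
      have "act K0 x y \<in> {None, Some 2}"
        using *(3) Cons \<open>J = y # J1\<close> by (auto split: if_splits)
      then show ?thesis using quiet Cons \<open>J = y # J1\<close> * by simp
    qed
  qed
  ultimately show ?thesis ..
qed

lemma good_label:
  assumes "rcfg K0 s0 K w" "St K # w = (u @ [a]) @ v" "labrun c v v' p J" "lab p a b q"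
    "\<forall>b\<in>set v'. \<not> is_St b"
  shows "good K0 s0 (map (Lt c) (rev u) @ [Bot]) (Lb c p a b q # J @ [Bot])"
proof (cases "u = []")
  case False
  have "labrun c (a # v) (b # v') q (Lb c p a b q # J)"
    using assms by (intro labrun.Cons)
  from labelling[OF assms(1) _ False _ this] show ?thesis
    using assms(2) by simp
next
  \<comment> \<open>The label of the state letter completes the step: the old configuration has been
    popped, \<open>J\<close> outputs the new one, and the colour flips.\<close>
  case True
  with assms(2) have [simp]: "a = St K" "v = w" by auto
  from assms(4) obtain K' where [simp]: "b = St K'" "q = p" and tr: "kstep K p K'"
    by (auto simp: lab_def)
  have w: "\<forall>a\<in>set w. \<not> is_St a" using assms(1) by (simp add: rcfg_def)
  have "rcfg K0 s0 K' v'"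
    using assms(1,5) labrun_isem[OF assms(3)] w tr unfolding rcfg_def
    by (auto intro: rtranclp.rtrancl_into_rtrancl mstep.intros)
  moreover have "map (out K0) (Lb c p a b q # J) = map (Lt (\<not> c)) (St K' # v')"
    using labrun_out[OF assms(3)] by simp
  ultimately show ?thesis
    using copying[of K0 s0 K' v' "[]" "St K' # v'" "Lb c p a b q # J" "\<not> c"] True by simp
qed

lemma good_letter:
  assumes "good K0 s0 (x # P) (y # Q)" "A x z = Some k" "A y z = Some l"
  shows "good K0 s0 (rev (take k [x, z]) @ P) (rev (take l [y, z]) @ Q) \<or>
    mstep\<^sup>*\<^sup>* (K0, s0) ([], \<lambda>_. 0)"
  using assms(1)
proof cases
  case (copying K w u v J c)
  note xz = sub[OF assms(2)] and yz = sub[OF assms(3)]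
  have w: "\<forall>a\<in>set w. \<not> is_St a" using copying(3) by (simp add: rcfg_def)
  show ?thesis
  proof (cases u rule: rev_cases)
    case Nil
    then have [simp]: "x = Bot" "P = []" "v = St K # w"
      using copying(1,4) by auto
    from copying(5) obtain j J' where J: "J = j # J'" "out K0 j = Lt c (St K)"
      "map (out K0) J' = map (Lt c) w"
      by auto
    then have [simp]: "y = j" "Q = J' @ [Bot]" using copying(2) by auto
    have [simp]: "z = Lt c (St K)" "l = 0"
      using J(2) yz xz by (auto simp: out_eq_Lt split: if_splits; cases z; auto split: if_splits)+
    have "k = 2" using xz by simp
    then show ?thesis
      using good.copying[OF copying(3), of "[St K]" w J' c] J(3) by simp
  next
    case (snoc u' a)
    then have [simp]: "x = Lt c a" "P = map (Lt c) (rev u') @ [Bot]"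
      using copying(1) by auto
    show ?thesis
    proof (cases J)
      \<comment> \<open>With the right stack exhausted, a pad may extend the configuration, a label
        may start rewriting it, or \<open>Fin\<close> may remove a trailing pad or find the final
        state letter.\<close>
      case Nil
      then have [simp]: "y = Bot" "Q = []" "v = []" using copying(2,5) by auto
      show ?thesis
      proof (cases z)
        case (Lt c' b)
        then have [simp]: "c' = c" "b = Pad" "k = 2" "l = 1"
          using xz yz by (auto split: if_splits letter.splits)
        have "rcfg K0 s0 K (w @ [Pad])"
          using copying(3) by (auto simp: rcfg_def)
        from good.copying[OF this, of "u @ [Pad]" "[]" "[]" c] show ?thesis
          using copying(4) Lt snoc by simp
      next
        case (Lb c' p a' b q)
        then have [simp]: "c' = c" "a' = a" "k = 0" "l = 2" and lab: "initial p" "lab p a b q"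
          using xz yz by (auto split: if_splits)
        show ?thesis
          using good_label[OF copying(3) _ labrun.Nil[OF lab(1)] lab(2)] copying(4) snoc Lb by simp
      next
        case (Fin c' a')
        then have [simp]: "c' = c" "a' = a" "k = 0" "l = 1" and "a = Pad \<or> a = St []"
          using xz yz by (auto split: if_splits)
        from this(5) show ?thesis
        proof
          assume [simp]: "a = Pad"
          obtain w' where w': "u' = St K # w'" "w = w' @ [Pad]"
            using copying(4) snoc by (cases u') auto
          then have "rcfg K0 s0 K w'"
            using copying(3) by (simp add: rcfg_def)
          from good.copying[OF this, of u' "[]" "[]" c] show ?thesis
            using w' Fin by simp
        next
          assume [simp]: "a = St []"
          have "K = [] \<and> w = []"
            using copying(4) snoc w by (cases u') auto
          then show ?thesis using copying(3) by (simp add: rcfg_def)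
        qed
      qed (use yz in auto)
    next
      case (Cons j J')
      then obtain b v' where [simp]: "v = b # v'" and J: "out K0 j = Lt c b"
        "map (out K0) J' = map (Lt c) v'"
        using copying(5) by auto
      have [simp]: "y = j" "Q = J' @ [Bot]" using copying(2) Cons by auto
      have [simp]: "z = Lt c b" "l = 0" "k = 2"
        using J(1) yz xz by (auto simp: out_eq_Lt split: if_splits; cases z; auto split: if_splits)+
      show ?thesis
        using good.copying[OF copying(3), of "u @ [b]" v' J' c] copying(4) J(2) snoc by simp
    qed
  qed
next
  case (labelling K w u v J c v' q)
  note xz = sub[OF assms(2)] and yz = sub[OF assms(3)]
  obtain u' a where snoc: "u = u' @ [a]" using labelling(5) by (cases u rule: rev_cases) auto
  have [simp]: "x = Lt c a" "P = map (Lt c) (rev u') @ [Bot]"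
    using labelling(1) snoc by auto
  from labelling(7,6) obtain v1 v1' p J' a1 b1 where
    J: "J = Lb c p a1 b1 q # J'" "v' = b1 # v1'" "v = a1 # v1"
      "\<forall>b\<in>set v1'. \<not> is_St b"
    by (cases rule: labrun.cases) auto
  have [simp]: "y = Lb c p a1 b1 q" "Q = J' @ [Bot]" using labelling(2) J by auto
  from yz xz obtain b q' where [simp]: "z = Lb c q a b q'" "k = 0" "l = 2"
    and lab: "lab q a b q'" and "\<not> is_St b1"
    by (cases z) (auto split: if_splits)
  have "\<forall>b\<in>set v'. \<not> is_St b" using J \<open>\<not> is_St b1\<close> by simp
  from good_label[OF labelling(3) _ labelling(7) lab this] show ?thesis
    using labelling(4) snoc J by simp
qed

lemma merge_msteps:
  assumes "good K0 s0 P Q" "run Mk A P W = run Mk A Q W"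
  shows "mstep\<^sup>*\<^sup>* (K0, s0) ([], \<lambda>_. 0)"
  by (rule merge_sound[where good = "good K0 s0", OF unmarked good_distinct good_nonempty good_no_marker
        good_letter good_quiet assms])

end

section \<open>Completeness of the simulation\<close>

definition restrict :: "sym set \<Rightarrow> cmd list \<Rightarrow> sym \<Rightarrow> sym \<Rightarrow> nat option" where
  "restrict D K0 x y = (if x \<in> D \<and> y \<in> D then act K0 x y else None)"

lemma table_restrict: "table K0 (restrict D K0)"
  by unfold_locales (simp add: restrict_def split: if_splits)

definition marked :: "sym list \<Rightarrow> sym list" where
  "marked zs = concat (map (\<lambda>z. [z, Mk]) zs)"

lemma marked_Nil [simp]: "marked [] = []"
  by (simp add: marked_def)

lemma marked_append [simp]: "marked (zs @ zs') = marked zs @ marked zs'"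
  by (simp add: marked_def)

lemma marked_in_lists: "set zs \<subseteq> D \<Longrightarrow> Mk \<in> D \<Longrightarrow> marked zs \<in> lists D"
  by (auto simp: marked_def)

abbreviation config :: "bool \<Rightarrow> letter list \<Rightarrow> sym list" where
  "config c v \<equiv> rev (map (Lt c) v) @ [Bot]"

definition syms :: "letter set \<Rightarrow> instr set \<Rightarrow> sym set" where
  "syms L Q = {Bot, Mk, Init} \<union> (\<lambda>(c, a). Lt c a) ` (UNIV \<times> L) \<union>
     (\<lambda>(c, p, a, b, q). Lb c p a b q) ` (UNIV \<times> Q \<times> L \<times> L \<times> Q) \<union>
     (\<lambda>(c, a). Fin c a) ` (UNIV \<times> L)"

lemma finite_syms: "finite L \<Longrightarrow> finite Q \<Longrightarrow> finite (syms L Q)"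
  by (simp add: syms_def)

lemma in_syms [simp]:
  "Bot \<in> syms L Q" "Mk \<in> syms L Q" "Init \<in> syms L Q"
  "Lt c a \<in> syms L Q \<longleftrightarrow> a \<in> L" "Fin c a \<in> syms L Q \<longleftrightarrow> a \<in> L"
  "Lb c p a b q \<in> syms L Q \<longleftrightarrow> p \<in> Q \<and> a \<in> L \<and> b \<in> L \<and> q \<in> Q"
  by (auto simp: syms_def image_iff)

text \<open>\<open>N\<close> has to contain the registers that can ever hold a token: register 0
  carries the input, and the others are filled by \<open>Inc\<close> only.\<close>

locale finite_machine =
  fixes K0 :: "cmd list" and R :: "cmd list set" and N :: "nat set" and Q :: "instr set"
  assumes K0: "K0 \<in> R" and halt: "[] \<in> R" and zero: "0 \<in> N" and Nop: "Nop \<in> Q"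
    and closed: "K \<in> R \<Longrightarrow> kstep K q K' \<Longrightarrow> K' \<in> R \<and> q \<in> Q"
    and Inc: "Inc r \<in> Q \<Longrightarrow> r \<in> N"
begin

definition letters :: "letter set" where
  "letters = insert Pad (Tok ` N \<union> St ` R)"

abbreviation D :: "sym set" where
  "D \<equiv> syms letters Q"

abbreviation rn :: "sym list \<Rightarrow> sym list \<Rightarrow> sym list" where
  "rn \<equiv> run Mk (restrict D K0)"

lemma in_letters [simp]:
  "Pad \<in> letters" "Tok r \<in> letters \<longleftrightarrow> r \<in> N" "St K \<in> letters \<longleftrightarrow> K \<in> R"
  by (auto simp: letters_def)

lemma run_marked_Cons:
  "restrict D K0 x z = Some k \<Longrightarrow> z \<noteq> Mk \<Longrightarrow>
   rn (x # st) (marked (z # zs)) = rn (rev (take k [x, z]) @ st) (marked zs)"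
  by (simp add: stp_push marked_def)

lemma push_letters:
  "\<forall>a\<in>set v. \<not> is_St a \<Longrightarrow> set (x # v) \<subseteq> letters \<Longrightarrow>
   rn (Lt c x # st) (marked (map (Lt c) v)) = rev (map (Lt c) v) @ Lt c x # st"
proof (induction v arbitrary: x st)
  case (Cons a v)
  have "restrict D K0 (Lt c x) (Lt c a) = Some 2"
    using Cons.prems by (simp add: restrict_def)
  from run_marked_Cons[OF this] show ?case
    using Cons by simp
qed simp

lemma push_config:
  assumes "K \<in> R" "\<forall>a\<in>set w. \<not> is_St a" "set w \<subseteq> letters"
  shows "rn [Bot] (marked (map (Lt c) (St K # w))) = config c (St K # w)"
proof -
  have "restrict D K0 Bot (Lt c (St K)) = Some 2"
    using assms by (simp add: restrict_def)
  from run_marked_Cons[OF this, of "[]" "map (Lt c) w"] show ?thesis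
    using push_letters[of w "St K" c "[Bot]"] assms by simp
qed

lemma skip_pads: "set v \<subseteq> {Pad} \<Longrightarrow> rn [Bot] (marked (map (Lt c) v)) = [Bot]"
proof (induction v)
  case (Cons a v)
  have "restrict D K0 Bot (Lt c a) = Some 1"
    using Cons.prems by (simp add: restrict_def)
  from run_marked_Cons[OF this] show ?case
    using Cons by simp
qed simp

lemma pop_letters_by_labels:
  "labrun c v v' q J \<Longrightarrow> set J \<subseteq> D \<Longrightarrow> set v \<subseteq> letters \<Longrightarrow>
   rn (rev (map (Lt c) v) @ st) (marked (rev J)) = st"
proof (induction arbitrary: st rule: labrun.induct)
  case (Cons v v' p J a b q)
  have "restrict D K0 (Lt c a) (Lb c p a b q) = Some 0"
    using Cons.prems by (simp add: restrict_def)
  from run_marked_Cons[OF this, of st "[]"]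
  have "rn (Lt c a # st) (marked [Lb c p a b q]) = st"
    by simp
  moreover have "rn (rev (map (Lt c) v) @ Lt c a # st) (marked (rev J)) = Lt c a # st"
    using Cons by simp
  ultimately show ?case
    by simp
qed simp

lemma push_labels:
  "labrun c v v' q J \<Longrightarrow> set J \<subseteq> D \<Longrightarrow> rn [Bot] (marked (rev J)) = J @ [Bot]"
proof (induction rule: labrun.induct)
  case (Cons v v' p J a b q)
  obtain y st where y: "J @ [Bot] = y # st"
    by (cases "J @ [Bot]") auto
  have "restrict D K0 y (Lb c p a b q) = Some 2"
    using Cons.hyps(1)
  proof cases
    case Nil
    then show ?thesis using Cons y by (auto simp: restrict_def)
  next
    case (Cons v1 v1' p' J1 a' b')
    then show ?thesis using Cons.hyps Cons.prems y \<open>lab p a b q\<close>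
        \<open>\<forall>b\<in>set v'. \<not> is_St b\<close> \<open>set (Lb c p a b q # J) \<subseteq> D\<close>
      by (auto simp: restrict_def)
  qed
  from run_marked_Cons[OF this, of st "[]"]
  have "rn (y # st) (marked [Lb c p a b q]) = Lb c p a b q # J @ [Bot]"
    by (simp add: y)
  moreover have "rn [Bot] (marked (rev J)) = y # st"
    using Cons y by simp
  ultimately show ?case
    by simp
qed simp

lemma pop_labels_by_letters:
  "map (out K0) J = map (Lt c) v \<Longrightarrow> set J \<subseteq> D \<Longrightarrow> set v \<subseteq> letters \<Longrightarrow>
   rn (J @ st) (marked (map (Lt c) v)) = st"
proof (induction J arbitrary: v)
  case (Cons j J)
  then obtain a v' where v: "v = a # v'" "out K0 j = Lt c a" "map (out K0) J = map (Lt c) v'"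
    by auto
  have "restrict D K0 j (Lt c a) = Some 0"
    using Cons.prems v by (auto simp: restrict_def out_eq_Lt)
  from run_marked_Cons[OF this] show ?case
    using Cons v by simp
qed simp

lemma pop_final:
  "set v \<subseteq> {Pad, St []} \<Longrightarrow> rn (map (Lt c) v @ st) (marked (map (Fin c) v)) = st"
proof (induction v)
  case (Cons a v)
  have "restrict D K0 (Lt c a) (Fin c a) = Some 0"
    using Cons.prems halt by (auto simp: restrict_def)
  from run_marked_Cons[OF this] show ?case
    using Cons by simp
qed simp

lemma skip_final:
  "set v \<subseteq> letters \<Longrightarrow> rn [Bot] (marked (map (Fin c) v)) = [Bot]"
proof (induction v)
  case (Cons a v)
  have "restrict D K0 Bot (Fin c a) = Some 1"
    using Cons.prems by (simp add: restrict_def)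
  from run_marked_Cons[OF this] show ?case
    using Cons by simp
qed simp

lemma labrun_syms:
  "labrun c v v' q J \<Longrightarrow> q \<in> Q \<Longrightarrow> set v \<subseteq> letters \<Longrightarrow> set v' \<subseteq> letters \<Longrightarrow> set J \<subseteq> D"
proof (induction rule: labrun.induct)
  case (Cons v v' p J a b q)
  have "p \<in> Q" using \<open>lab p a b q\<close> \<open>q \<in> Q\<close> Nop by (auto simp: lab_def)
  with Cons show ?case by simp
qed simp

lemma labrun_copy:
  assumes "labrun c v v' q J" "\<forall>a\<in>set w. \<not> is_St a" "\<forall>b\<in>set v'. \<not> is_St b"
    "\<And>r. q = IsZero r \<Longrightarrow> Tok r \<notin> set w"
  shows "\<exists>J. labrun c (w @ v) (w @ v') q J"
  using assms(2,4)
proof (induction w)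
  case Nil
  then show ?case using assms(1) by auto
next
  case (Cons a w)
  then obtain J' where J': "labrun c (w @ v) (w @ v') q J'" by auto
  have "lab q a a q" using Cons.prems by (auto simp: lab_def)
  moreover have "\<forall>b\<in>set (w @ v'). \<not> is_St b" using Cons.prems assms(3) by auto
  ultimately have "labrun c (a # w @ v) (a # w @ v') q (Lb c q a a q # J')"
    using labrun.Cons[OF J'] by blast
  then show ?case by auto
qed

text \<open>Labels never insert or delete a letter: \<open>Inc r\<close> overwrites a pad supplied
  at the right end, and \<open>Dec r\<close> leaves a pad behind.\<close>

lemma labrun_isem_exists:
  assumes "isem q (cnt w) s" "\<forall>a\<in>set w. \<not> is_St a" "set w \<subseteq> letters" "q \<in> Q"
  shows "\<exists>pads w' J. set pads \<subseteq> {Pad} \<and> labrun c (w @ pads) w' q J \<and> cnt w' = s \<and>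
    (\<forall>a\<in>set w'. \<not> is_St a) \<and> set w' \<subseteq> letters"
proof (cases q)
  case Nop
  have "labrun c [] [] q []" using Nop by (simp add: labrun.Nil initial_def)
  from labrun_copy[OF this, of w] assms Nop obtain J where "labrun c (w @ []) w q J"
    by auto
  with assms Nop show ?thesis
    by (intro exI[of _ "[]"] exI[of _ w] exI[of _ J]) simp
next
  case (IsZero r)
  have "labrun c [] [] q []" using IsZero by (simp add: labrun.Nil initial_def)
  moreover have "Tok r \<notin> set w"
    using assms(1) IsZero by (simp add: cnt_def count_list_0_iff)
  ultimately obtain J where "labrun c (w @ []) w q J"
    using labrun_copy[of c "[]" "[]" q "[]" w] assms IsZero by auto
  with assms IsZero show ?thesis
    by (intro exI[of _ "[]"] exI[of _ w] exI[of _ J]) simp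
next
  case (Inc r)
  have "labrun c [] [] Nop []" by (simp add: labrun.Nil initial_def)
  moreover have "lab Nop Pad (Tok r) q" by (simp add: lab_def Inc)
  ultimately have "labrun c [Pad] [Tok r] q [Lb c Nop Pad (Tok r) q]"
    using labrun.Cons by fastforce
  from labrun_copy[OF this, of w] assms Inc
  obtain J where "labrun c (w @ [Pad]) (w @ [Tok r]) q J" by auto
  moreover have "r \<in> N"
    using Inc \<open>q \<in> Q\<close> finite_machine_axioms finite_machine.Inc by blast
  moreover have "cnt (w @ [Tok r]) = s"
    using assms(1) Inc by (auto simp: fun_eq_iff)
  ultimately show ?thesis
    using assms by (intro exI[of _ "[Pad]"] exI[of _ "w @ [Tok r]"] exI[of _ J]) auto
next
  case (Dec r)
  then have "Tok r \<in> set w"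
    using assms(1) by (auto simp: cnt_def count_list_0_iff[symmetric] intro: ccontr)
  then obtain w1 w2 where w: "w = w1 @ Tok r # w2"
    by (meson split_list)
  have "labrun c [] [] Nop []" by (simp add: labrun.Nil initial_def)
  from labrun_copy[OF this, of w2] assms w obtain J where "labrun c w2 w2 Nop J" by auto
  moreover have "lab Nop (Tok r) Pad q" by (simp add: lab_def Dec)
  ultimately have "labrun c (Tok r # w2) (Pad # w2) q (Lb c Nop (Tok r) Pad q # J)"
    using assms w by (intro labrun.Cons) auto
  from labrun_copy[OF this, of w1] assms Dec w
  obtain J where "labrun c (w1 @ Tok r # w2) (w1 @ Pad # w2) q J" by auto
  moreover have "cnt (w1 @ Pad # w2) = s"
    using assms(1) Dec w by (auto simp: fun_eq_iff)
  ultimately show ?thesis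
    using assms w by (intro exI[of _ "[]"] exI[of _ "w1 @ Pad # w2"] exI[of _ J]) auto
qed

text \<open>The word consists of pads, the labels from the last letter to the first, and the next
  configuration. One stack is extended, emptied and refilled; the other drops the pads, stores the
  labels and loses them again.\<close>

lemma step_run:
  assumes "K \<in> R" "kstep K q K'" "isem q (cnt w) s" "\<forall>a\<in>set w. \<not> is_St a" "set w \<subseteq> letters"
  shows "\<exists>W w'. W \<in> lists D \<and> cnt w' = s \<and> (\<forall>a\<in>set w'. \<not> is_St a) \<and> set w' \<subseteq> letters \<and>
    rn (config c (St K # w)) W = config (\<not> c) (St K' # w') \<and> rn [Bot] W = [Bot]"
proof -
  have K': "K' \<in> R" "q \<in> Q" using closed assms by auto
  obtain pads w' J0 where pads: "set pads \<subseteq> {Pad}" and J0: "labrun c (w @ pads) w' q J0"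
    and w': "cnt w' = s" "\<forall>a\<in>set w'. \<not> is_St a" "set w' \<subseteq> letters"
    using labrun_isem_exists[OF assms(3-5) K'(2)] by blast
  have "lab q (St K) (St K') q" using assms(2) by (simp add: lab_def)
  then obtain J where J: "labrun c (St K # w @ pads) (St K' # w') q J"
    using labrun.Cons[OF J0 w'(2)] by blast
  have sub: "set (St K # w @ pads) \<subseteq> letters" "set (St K' # w') \<subseteq> letters"
    using assms K' w' pads by auto
  have JD: "set J \<subseteq> D" by (rule labrun_syms[OF J K'(2) sub])
  let ?W1 = "marked (map (Lt c) pads)" and ?W2 = "marked (rev J)"
    and ?W3 = "marked (map (Lt (\<not> c)) (St K' # w'))"
  have "rn (config c (St K # w)) ?W1 = config c (St K # w @ pads)"
  proof -
    obtain x v where xv: "rev (St K # w) = x # v" by (cases "rev (St K # w)") auto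
    then have "x \<in> set (St K # w)" by (metis list.set_intros(1) set_rev)
    then have "x \<in> letters" using assms by auto
    moreover have "\<forall>a\<in>set pads. \<not> is_St a" "set pads \<subseteq> letters" using pads by auto
    ultimately have "rn (map (Lt c) (x # v) @ [Bot]) ?W1 = rev (map (Lt c) pads) @ map (Lt c) (x # v) @ [Bot]"
      using push_letters[of pads x c "map (Lt c) v @ [Bot]"] by simp
    then show ?thesis unfolding xv[symmetric] by (simp add: rev_map)
  qed
  moreover have "rn (config c (St K # w @ pads)) ?W2 = [Bot]"
    by (rule pop_letters_by_labels[OF J JD sub(1)])
  moreover have "rn [Bot] ?W3 = config (\<not> c) (St K' # w')"
    by (rule push_config) (use K' w' in auto)
  ultimately have "rn (config c (St K # w)) (?W1 @ ?W2 @ ?W3) = config (\<not> c) (St K' # w')"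
    by (simp only: foldl_append)
  moreover have "rn [Bot] (?W1 @ ?W2 @ ?W3) = [Bot]"
    unfolding foldl_append skip_pads[OF pads] push_labels[OF J JD]
    by (rule pop_labels_by_letters[OF labrun_out[OF J] JD sub(2)])
  moreover have "?W1 @ ?W2 @ ?W3 \<in> lists D"
    unfolding append_in_lists_conv using JD sub by (intro conjI marked_in_lists) auto
  ultimately show ?thesis
    using w' by blast
qed

lemma msteps_run:
  assumes "mstep\<^sup>*\<^sup>* (K0, s0) p" "cnt w0 = s0" "\<forall>a\<in>set w0. \<not> is_St a" "set w0 \<subseteq> letters"
  shows "fst p \<in> R \<and> (\<exists>W c w. W \<in> lists D \<and> cnt w = snd p \<and> (\<forall>a\<in>set w. \<not> is_St a) \<and>
    set w \<subseteq> letters \<and> rn (config True (St K0 # w0)) W = config c (St (fst p) # w) \<and>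
    rn [Bot] W = [Bot])"
  using assms(1)
proof (induction rule: rtranclp_induct)
  case base
  show ?case
    using assms K0 by (auto intro!: exI[of _ "[]"] exI[of _ True] exI[of _ w0])
next
  case (step p p')
  then obtain K s q K' s' where p: "p = (K, s)" "p' = (K', s')" and tr: "kstep K q K'" "isem q s s'"
    by (auto elim: mstep.cases)
  from step.IH p obtain W c w where W: "W \<in> lists D" and w: "cnt w = s" "\<forall>a\<in>set w. \<not> is_St a"
    "set w \<subseteq> letters" and "K \<in> R" and runs: "rn (config True (St K0 # w0)) W = config c (St K # w)"
    "rn [Bot] W = [Bot]"
    by auto
  from step_run[OF \<open>K \<in> R\<close> tr(1), of w s' c] w tr(2)
  obtain W' w' where W': "W' \<in> lists D" "cnt w' = s'" "\<forall>a\<in>set w'. \<not> is_St a" "set w' \<subseteq> letters"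
    "rn (config c (St K # w)) W' = config (\<not> c) (St K' # w')" "rn [Bot] W' = [Bot]"
    by blast
  have "rn (config True (St K0 # w0)) (W @ W') = config (\<not> c) (St K' # w')" "rn [Bot] (W @ W') = [Bot]"
    using runs W' by (simp_all only: foldl_append)
  moreover have "K' \<in> R" using closed \<open>K \<in> R\<close> tr(1) by blast
  ultimately show ?case
    using W W' p by (intro conjI exI[of _ "W @ W'"] exI[of _ "\<not> c"] exI[of _ w']) auto
qed

lemma cnt_replicate: "cnt (replicate n (Tok 0)) = (\<lambda>_. 0)(0 := n)"
  by (induction n) (auto simp: fun_eq_iff)

text \<open>The stack pretends that labels of colour \<open>False\<close> have just produced the
  initial configuration. \<open>Init\<close> replaces the label of its state letter, so
  \<open>K0\<close> is not mentioned.\<close>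

definition start :: "nat \<Rightarrow> sym list" where
  "start n = Init # replicate n (Lb False Nop (Tok 0) (Tok 0) Nop) @ [Bot]"

lemma merge_if_halts:
  assumes "mstep\<^sup>*\<^sup>* (K0, (\<lambda>_. 0)(0 := n)) ([], \<lambda>_. 0)"
  shows "\<exists>W\<in>lists D. rn [Bot] W = rn (start n) W"
proof -
  define w0 where "w0 = replicate n (Tok 0)"
  have w0: "cnt w0 = (\<lambda>_. 0)(0 := n)" "\<forall>a\<in>set w0. \<not> is_St a" "set w0 \<subseteq> letters"
    unfolding w0_def cnt_replicate using zero by auto
  from msteps_run[OF assms w0] obtain W c w where W: "W \<in> lists D" and
    w: "cnt w = (\<lambda>_. 0)" "\<forall>a\<in>set w. \<not> is_St a" "set w \<subseteq> letters" and
    runs: "rn (config True (St K0 # w0)) W = config c (St [] # w)" "rn [Bot] W = [Bot]"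
    by auto
  have "Tok r \<notin> set w" for r
    using w(1) by (simp add: cnt_def fun_eq_iff count_list_0_iff)
  then have "set w \<subseteq> {Pad}"
    using w(2) by (metis insertI1 is_St.simps(3) letter.exhaust subsetI)
  then have fin: "set (rev (St [] # w)) \<subseteq> {Pad, St []}" by auto
  \<comment> \<open>\<open>?W1\<close> fills the left stack and consumes \<open>start n\<close>;
    \<open>?W3\<close> removes the final configuration from its last letter on and is dropped by the
    other stack.\<close>
  let ?W1 = "marked (map (Lt True) (St K0 # w0))" and ?W3 = "marked (map (Fin c) (rev (St [] # w)))"
  have "rn [Bot] ?W1 = config True (St K0 # w0)"
    by (rule push_config) (use K0 w0 in auto)
  moreover have "rn (config c (St [] # w)) ?W3 = [Bot]"
    using pop_final[OF fin, of c "[Bot]"] by (simp only: rev_map)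
  ultimately have alpha: "rn [Bot] (?W1 @ W @ ?W3) = [Bot]"
    using runs by (simp only: foldl_append)
  have "rn (start n) ?W1 = [Bot]"
  proof -
    have "start n = (Init # replicate n (Lb False Nop (Tok 0) (Tok 0) Nop)) @ [Bot]"
      by (simp add: start_def)
    moreover have "map (out K0) (Init # replicate n (Lb False Nop (Tok 0) (Tok 0) Nop)) =
        map (Lt True) (St K0 # w0)"
      by (simp add: w0_def)
    ultimately show ?thesis
      using pop_labels_by_letters[of "Init # replicate n (Lb False Nop (Tok 0) (Tok 0) Nop)" True
          "St K0 # w0" "[Bot]"] Nop zero K0 w0
      by (auto simp del: list.map simp: set_replicate_conv_if split: if_splits)
  qed
  moreover have "rn [Bot] ?W3 = [Bot]"
    by (rule skip_final) (use fin halt in auto)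
  ultimately have "rn (start n) (?W1 @ W @ ?W3) = [Bot]"
    using runs by (simp only: foldl_append)
  moreover have "?W1 @ W @ ?W3 \<in> lists D"
    unfolding append_in_lists_conv using W K0 w0 w halt by (intro conjI marked_in_lists) auto
  ultimately show ?thesis
    using alpha by metis
qed

lemma halts_if_merge:
  assumes "rn [Bot] W = rn (start n) W"
  shows "mstep\<^sup>*\<^sup>* (K0, (\<lambda>_. 0)(0 := n)) ([], \<lambda>_. 0)"
proof -
  interpret table K0 "restrict D K0" by (rule table_restrict)
  define w0 where "w0 = replicate n (Tok 0)"
  have "cnt w0 = (\<lambda>_. 0)(0 := n)"
    by (simp only: w0_def cnt_replicate)
  then have "rcfg K0 ((\<lambda>_. 0)(0 := n)) K0 w0"
    unfolding rcfg_def by (simp add: w0_def)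
  from good.copying[OF this, of "[]" "St K0 # w0"
      "Init # replicate n (Lb False Nop (Tok 0) (Tok 0) Nop)" True]
  have "good K0 ((\<lambda>_. 0)(0 := n)) [Bot] (start n)"
    by (simp add: w0_def start_def)
  from merge_msteps[OF this assms] show ?thesis .
qed

end

lemma finite_machine_exists:
  "\<exists>R N Q. finite_machine [c] R N Q \<and> finite R \<and> finite N \<and> finite Q"
proof -
  define R where "R = insert [] (conts c [])"
  define Q where "Q = insert Nop ((\<lambda>K. case K of Prim q # _ \<Rightarrow> q | _ \<Rightarrow> Nop) ` R)"
  define N where "N = insert 0 ((\<lambda>q. case q of Inc r \<Rightarrow> r | _ \<Rightarrow> 0) ` Q)"
  have "finite R" by (simp add: R_def finite_conts)
  then have fin: "finite R" "finite N" "finite Q" by (simp_all add: N_def Q_def)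
  have "K' \<in> R \<and> q \<in> Q" if "K \<in> R" "kstep K q K'" for K q K'
  proof
    from that(2) have "K \<noteq> []" by cases auto
    with that kstep_conts[of K c "[]" q K'] show "K' \<in> R" by (auto simp: R_def)
    have "q = (case K of Prim q # _ \<Rightarrow> q | _ \<Rightarrow> Nop)" using that(2) by cases auto
    with that(1) show "q \<in> Q" unfolding Q_def by blast
  qed
  moreover have "r \<in> N" if "Inc r \<in> Q" for r
  proof -
    have "r = (case Inc r of Inc r \<Rightarrow> r | _ \<Rightarrow> 0)" by simp
    with that show ?thesis unfolding N_def by blast
  qed
  ultimately have "finite_machine [c] R N Q"
    by unfold_locales (auto simp: R_def N_def Q_def Cons_in_conts)
  with fin show ?thesis by blast
qed

section \<open>Instances and diagonalisation\<close>

instance instr :: countable by countable_datatype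
instance cmd :: countable by countable_datatype
instance letter :: countable by countable_datatype
instance sym :: countable by countable_datatype

text \<open>One numbering of the symbols of all programs, independent of the alphabet
  \<open>D\<close> of any one of them.\<close>

definition code :: "sym \<Rightarrow> nat" where
  "code = to_nat_on UNIV"

lemma bij_code: "bij code"
proof -
  have "inj (Lt True \<circ> Tok)" by (auto simp: inj_def)
  then have "infinite (UNIV :: sym set)"
    by (metis finite_subset subset_UNIV finite_imageD infinite_UNIV_nat)
  then show ?thesis
    unfolding code_def by (intro to_nat_on_infinite) auto
qed

lemma inv_code [simp]: "inv code (code z) = z"
  by (simp add: bij_code bij_is_inj)

definition coded :: "sym set \<Rightarrow> cmd list \<Rightarrow> nat \<Rightarrow> nat \<Rightarrow> nat option" where
  "coded D K0 x y = restrict D K0 (inv code x) (inv code y)"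

definition left_word :: "nat list" where
  "left_word = [code Bot]"

definition right_word :: "nat \<Rightarrow> nat list" where
  "right_word n = code Bot # replicate n (code (Lb False Nop (Tok 0) (Tok 0) Nop)) @ [code Init]"

text \<open>Large enough for both words whatever the rules are, and positive.\<close>

definition offset :: nat where
  "offset = Suc (code Bot + code (Lb False Nop (Tok 0) (Tok 0) Nop) + code Init)"

definition instance_of :: "(nat list \<times> nat list) list \<Rightarrow> nat \<Rightarrow> ct_instance" where
  "instance_of rs n = (n + offset, left_word, right_word n, rs)"

lemma length_le_list_encode: "length xs \<le> list_encode xs"
proof (induction xs)
  case (Cons x xs)
  have "list_encode xs \<le> prod_encode (x, list_encode xs)"
    by (rule le_prod_encode_2)
  with Cons show ?case by simp
qed simp

text \<open>
  The input is supplied in unary, and the alphabet may be any size above the codes in use. As the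
  rules can be listed with repetitions, their own code can be made large enough to serve as the
  input and to bound the alphabet.
\<close>

lemma halting_instances:
  "\<exists>rs. let n = list_encode (map encode_rule rs) in
     instance_of rs n \<in> dwindling_ct_instances \<and>
     (instance_of rs n \<in> ct_yes_instances \<longleftrightarrow> (\<exists>y. computes f [n] y))"
proof -
  let ?c = "halting_cmd f"
  obtain R N Q where fm: "finite_machine [?c] R N Q" and fin: "finite R" "finite N" "finite Q"
    using finite_machine_exists by blast
  interpret finite_machine "[?c]" R N Q by (rule fm)
  interpret tab: table "[?c]" "restrict D [?c]" by (rule table_restrict)
  define B where "B = coded D [?c]"
  have B: "B (code x) (code y) = restrict D [?c] x y" for x y
    by (simp add: B_def coded_def)
  define S where "S = pair_rules (code Mk) B"
  have unmarked: "unmarked (code Mk) B"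
    using tab.unmarked by (simp add: unmarked_def B_def coded_def)
  have finD: "finite D"
    using fin by (intro finite_syms) (simp_all add: letters_def)
  have S: "\<exists>x\<in>D. \<exists>y\<in>D. \<exists>k. r = ([code x, code y, code Mk], take k [code x, code y])"
    if "r \<in> S" for r
  proof -
    from that obtain x y k where r: "r = ([x, y, code Mk], take k [x, y])"
      and k: "restrict D [?c] (inv code x) (inv code y) = Some k"
      by (auto simp: S_def pair_rules_def B_def coded_def)
    from k have "inv code x \<in> D" "inv code y \<in> D"
      by (auto simp: restrict_def split: if_splits)
    moreover have "code (inv code x) = x" "code (inv code y) = y"
      using bij_code by (simp_all add: bij_is_surj surj_f_inv_f)
    with r have "r = ([code (inv code x), code (inv code y), code Mk],
        take k [code (inv code x), code (inv code y)])"
      by simp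
    ultimately show ?thesis by blast
  qed
  have "S \<subseteq> (\<lambda>(x, y, k). ([code x, code y, code Mk], take k [code x, code y])) ` (D \<times> D \<times> {..2})"
  proof
    fix r
    assume "r \<in> S"
    then obtain x y k where "x \<in> D" "y \<in> D" "r = ([code x, code y, code Mk], take k [code x, code y])"
      using S by blast
    moreover have "take k [code x, code y] = take (min k 2) [code x, code y]"
      by (simp add: min_def)
    ultimately show "r \<in> (\<lambda>(x, y, k). ([code x, code y, code Mk], take k [code x, code y])) ` (D \<times> D \<times> {..2})"
      by (intro image_eqI[of _ _ "(x, y, min k 2)"]) simp_all
  qed
  then have "finite S"
    by (rule finite_subset) (use finD in auto)
  then obtain rs0 where rs0: "set rs0 = S"
    using finite_list by blast
  \<comment> \<open>Some rule must exist in order to be repeated in the list.\<close>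
  have "B (code Bot) (code (Fin True Pad)) = Some 1"
    unfolding B by (simp add: restrict_def)
  then have "([code Bot, code (Fin True Pad), code Mk], take 1 [code Bot, code (Fin True Pad)]) \<in> S"
    unfolding S_def pair_rules_def by blast
  then obtain r0 where r0: "r0 \<in> S" by blast
  obtain b where b: "\<forall>z\<in>D. code z < b"
    using finite_imageI[OF finD, of code] by (auto simp: finite_nat_set_iff_bounded)
  define rs where "rs = replicate b r0 @ rs0"
  have rs: "set rs = S" using r0 rs0 by (auto simp: rs_def)
  define n where "n = list_encode (map encode_rule rs)"
  have "b \<le> n"
    using length_le_list_encode[of "map encode_rule rs"] by (simp add: n_def rs_def)
  then have codeD: "code z < n + offset" if "z \<in> D" for z
    using b that by fastforce
  let ?\<Sigma> = "{..<n + offset}"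
  have over: "srs_over ?\<Sigma> S"
  proof -
    have "r \<in> lists ?\<Sigma> \<times> lists ?\<Sigma>" if "r \<in> S" for r
      using S[OF that] codeD by (auto dest!: in_set_takeD)
    then show ?thesis unfolding srs_over_def by blast
  qed
  have words: "left_word \<in> lists ?\<Sigma>" "right_word n \<in> lists ?\<Sigma>"
    by (auto simp: left_word_def right_word_def offset_def)
  have inst: "instance_of rs n \<in> dwindling_ct_instances"
    unfolding dwindling_ct_instances_def instance_of_def
    using words over dwindling_pair_rules convergent_pair_rules[OF unmarked] rs
    by (simp add: S_def offset_def)
  have left: "run (code Mk) B [] left_word = map code [Bot]"
    by (simp add: left_word_def)
  have right: "run (code Mk) B [] (right_word n) = map code (start n)"
  proof -
    have "code Mk \<notin> set (right_word n)"
      using bij_code by (auto simp: right_word_def bij_def inj_eq)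
    show ?thesis
      unfolding run_push[OF \<open>code Mk \<notin> set (right_word n)\<close>] by (simp add: right_word_def start_def)
  qed
  have equiv: "srs_equiv ?\<Sigma> S (left_word @ map code W) (right_word n @ map code W) \<longleftrightarrow>
      rn [Bot] W = rn (start n) W" if "map code W \<in> lists ?\<Sigma>" for W
  proof -
    have "srs_equiv ?\<Sigma> S (left_word @ map code W) (right_word n @ map code W) \<longleftrightarrow>
        run (code Mk) B (map code [Bot]) (map code W) = run (code Mk) B (map code (start n)) (map code W)"
    proof -
      have "left_word @ map code W \<in> lists ?\<Sigma>" "right_word n @ map code W \<in> lists ?\<Sigma>"
        using words that by (simp_all only: append_in_lists_conv)
      from srs_equiv_pair_rules_iff[OF unmarked this] show ?thesis
        by (simp only: S_def foldl_append left right)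
    qed
    also have "\<dots> \<longleftrightarrow> map code (rn [Bot] W) = map code (rn (start n) W)"
      by (simp only: run_map[of code B "restrict D [?c]", OF bij_is_inj[OF bij_code] B])
    also have "\<dots> \<longleftrightarrow> rn [Bot] W = rn (start n) W"
      using bij_code by (simp add: inj_map_eq_map bij_is_inj)
    finally show ?thesis .
  qed
  \<comment> \<open>A word over the numeric alphabet may use codes of symbols outside
    \<open>D\<close>. As \<open>code\<close> is onto, it still codes a word over \<open>sym\<close>,
    and soundness covers all of these.\<close>
  have surj: "\<exists>W'. W = map code W'" for W
    using bij_code by (metis bij_is_surj ex_map_conv surj_def)
  have "instance_of rs n \<in> ct_yes_instances \<longleftrightarrow>
      (\<exists>W\<in>lists ?\<Sigma>. srs_equiv ?\<Sigma> S (left_word @ W) (right_word n @ W))"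
    by (simp add: ct_yes_instances_def instance_of_def has_common_term_def rs)
  also have "\<dots> \<longleftrightarrow> (\<exists>W. map code W \<in> lists ?\<Sigma> \<and>
      srs_equiv ?\<Sigma> S (left_word @ map code W) (right_word n @ map code W))" (is "?L \<longleftrightarrow> ?R")
  proof
    assume ?L
    then obtain W where W: "W \<in> lists ?\<Sigma>" "srs_equiv ?\<Sigma> S (left_word @ W) (right_word n @ W)" ..
    obtain W' where "W = map code W'" using surj[of W] ..
    with W show ?R by (intro exI[of _ W']) simp
  next
    assume ?R
    then obtain W where "map code W \<in> lists ?\<Sigma>"
      "srs_equiv ?\<Sigma> S (left_word @ map code W) (right_word n @ map code W)" by blast
    then show ?L ..
  qed
  also have "\<dots> \<longleftrightarrow> (\<exists>W. map code W \<in> lists ?\<Sigma> \<and> rn [Bot] W = rn (start n) W)"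
    by (rule ex_cong1, rule conj_cong, rule refl, rule equiv)
  also have "\<dots> \<longleftrightarrow> mstep\<^sup>*\<^sup>* ([?c], (\<lambda>_. 0)(0 := n)) ([], \<lambda>_. 0)"
  proof
    assume "mstep\<^sup>*\<^sup>* ([?c], (\<lambda>_. 0)(0 := n)) ([], \<lambda>_. 0)"
    then obtain W where "W \<in> lists D" "rn [Bot] W = rn (start n) W"
      using merge_if_halts by blast
    then show "\<exists>W. map code W \<in> lists ?\<Sigma> \<and> rn [Bot] W = rn (start n) W"
      using codeD by (intro exI[of _ W]) auto
  qed (use halts_if_merge in blast)
  also have "\<dots> \<longleftrightarrow> (\<exists>y. computes f [n] y)"
    by (simp only: msteps_iff_sem sem_halting_cmd)
  finally have "instance_of rs n \<in> ct_yes_instances \<longleftrightarrow> (\<exists>y. computes f [n] y)" .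
  with inst show ?thesis
    by (intro exI[of _ rs]) (simp only: Let_def n_def[symmetric] simp_thms)
qed

section \<open>Recursive functions that assemble the code of an instance\<close>

primrec rconst :: "nat \<Rightarrow> recf" where
  "rconst 0 = Zero"
| "rconst (Suc k) = Comp Succ [rconst k]"

lemma computes_Comp1: "computes g xs y \<Longrightarrow> computes f [y] z \<Longrightarrow> computes (Comp f [g]) xs z"
  by (auto simp: computes_Comp_iff list_all2_Cons1)

lemma computes_Comp2:
  "computes g xs y \<Longrightarrow> computes h xs y' \<Longrightarrow> computes f [y, y'] z \<Longrightarrow> computes (Comp f [g, h]) xs z"
  by (auto simp: computes_Comp_iff list_all2_Cons1)

lemma computes_Proj: "i < length xs \<Longrightarrow> y = xs ! i \<Longrightarrow> computes (Proj i) xs y"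
  by (simp add: computes.Proj)

lemma computes_rconst: "computes (rconst k) xs k"
  by (induction k) (auto intro: computes.Zero computes.Succ computes_Comp1)

definition radd :: recf where
  "radd = PrimRec (Proj 0) (Comp Succ [Proj 1])"

lemma computes_radd: "computes radd [m, n] (m + n)"
  unfolding radd_def
proof (induction m)
  case 0
  show ?case by (auto intro!: computes.PrimRec_0 computes_Proj)
next
  case (Suc m)
  have "computes (Comp Succ [Proj 1]) [m, m + n, n] (Suc m + n)"
    using computes.Succ by (auto intro!: computes_Comp1[OF computes_Proj])
  with Suc show ?case by (rule computes.PrimRec_Suc)
qed

text \<open>Triangular numbers enter through the Cantor pairing \<open>prod_encode\<close>, on which
  \<open>list_encode\<close> is built.\<close>

definition rtriangle :: recf where
  "rtriangle = PrimRec Zero (Comp Succ [Comp radd [Proj 1, Proj 0]])"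

lemma computes_rtriangle: "computes rtriangle [n] (triangle n)"
  unfolding rtriangle_def
proof (induction n)
  case 0
  show ?case by (auto intro!: computes.PrimRec_0 computes.Zero)
next
  case (Suc n)
  have "computes (Comp radd [Proj 1, Proj 0]) [n, triangle n] (triangle n + n)"
    by (rule computes_Comp2[OF computes_Proj computes_Proj computes_radd]) simp_all
  then have "computes (Comp Succ [Comp radd [Proj 1, Proj 0]]) [n, triangle n] (triangle (Suc n))"
    using computes_Comp1 computes.Succ by fastforce
  with Suc show ?case by (rule computes.PrimRec_Suc)
qed

definition rcons :: recf where
  "rcons = Comp Succ [Comp radd [Comp rtriangle [radd], Proj 0]]"

lemma computes_rcons: "computes rcons [x, list_encode xs] (list_encode (x # xs))"
proof -
  let ?ys = "[x, list_encode xs]"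
  have "computes (Comp rtriangle [radd]) ?ys (triangle (x + list_encode xs))"
    by (rule computes_Comp1[OF computes_radd computes_rtriangle])
  then have "computes (Comp radd [Comp rtriangle [radd], Proj 0]) ?ys (prod_encode (x, list_encode xs))"
    unfolding prod_encode_def prod.case
    by (rule computes_Comp2[OF _ computes_Proj computes_radd]) simp_all
  then show ?thesis
    unfolding rcons_def list_encode.simps by (rule computes_Comp1[OF _ computes.Succ])
qed

lemma computes_Comp_rcons:
  "computes g ys x \<Longrightarrow> computes h ys (list_encode xs) \<Longrightarrow>
   computes (Comp rcons [g, h]) ys (list_encode (x # xs))"
  by (rule computes_Comp2[OF _ _ computes_rcons])

definition rreplicate :: "nat \<Rightarrow> nat list \<Rightarrow> recf" where
  "rreplicate x xs = PrimRec (rconst (list_encode xs)) (Comp rcons [rconst x, Proj 1])"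

lemma computes_rreplicate: "computes (rreplicate x xs) [n] (list_encode (replicate n x @ xs))"
  unfolding rreplicate_def
proof (induction n)
  case 0
  show ?case by (auto intro!: computes.PrimRec_0 computes_rconst)
next
  case (Suc n)
  have "computes (Comp rcons [rconst x, Proj 1]) [n, list_encode (replicate n x @ xs)]
      (list_encode (x # replicate n x @ xs))"
    by (rule computes_Comp_rcons[OF computes_rconst computes_Proj]) simp_all
  with Suc show ?case unfolding replicate_Suc append_Cons by (rule computes.PrimRec_Suc)
qed

definition rinstance :: recf where
  "rinstance =
     Comp rcons [Comp radd [Proj 0, rconst offset], Comp rcons [rconst (list_encode left_word),
       Comp rcons
         [Comp rcons [rconst (code Bot),
            rreplicate (code (Lb False Nop (Tok 0) (Tok 0) Nop)) [code Init]],
          Comp rcons [Proj 0, Zero]]]]"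

lemma computes_rinstance:
  assumes "n = list_encode (map encode_rule rs)"
  shows "computes rinstance [n] (encode_instance (instance_of rs n))"
proof -
  have n: "computes (Proj 0) [n] n"
    by (rule computes_Proj) simp_all
  have nil: "computes Zero [n] (list_encode [])"
    using computes.Zero by simp
  show ?thesis
    unfolding rinstance_def encode_instance_def instance_of_def prod.case assms[symmetric] right_word_def
    by (intro computes_Comp_rcons computes_rconst computes_rreplicate n nil
        computes_Comp2[OF n computes_rconst computes_radd])
qed

section \<open>The diagonal argument\<close>

definition halt_on_zero :: "recf \<Rightarrow> recf" where
  "halt_on_zero d = Comp (Mu (Proj 1)) [Comp d [rinstance]]"

lemma computes_halt_on_zero_iff:
  assumes "computes rinstance [n] m"
  shows "(\<exists>y. computes (halt_on_zero d) [n] y) \<longleftrightarrow> computes d [m] 0"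
proof -
  have proj: "computes (Proj 1) [i, v] z \<longleftrightarrow> z = v" for i v z
    using computes_Proj[of 1 "[i, v]"] by (auto elim: computes_ProjE)
  \<comment> \<open>\<open>Proj 1\<close> ignores the search variable, so the search stops at once
    if \<open>v\<close> is zero and never otherwise.\<close>
  have mu: "(\<exists>y. computes (Mu (Proj 1)) [v] y) \<longleftrightarrow> v = 0" for v
    unfolding computes_Mu_iff proj by auto
  have "computes rinstance [n] u \<longleftrightarrow> u = m" for u
    using assms computes_functional by blast
  then have "computes (halt_on_zero d) [n] y \<longleftrightarrow>
      (\<exists>v. computes d [m] v \<and> computes (Mu (Proj 1)) [v] y)" for y
    by (auto simp: halt_on_zero_def computes_Comp_iff list_all2_Cons1)
  then have "(\<exists>y. computes (halt_on_zero d) [n] y) \<longleftrightarrow>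
      (\<exists>v. computes d [m] v \<and> (\<exists>y. computes (Mu (Proj 1)) [v] y))"
    by blast
  then show ?thesis
    by (simp only: mu) simp
qed

theorem theorem1:
  shows "\<not> decidable_problem encode_instance dwindling_ct_instances ct_yes_instances"
proof
  assume "decidable_problem encode_instance dwindling_ct_instances ct_yes_instances"
  then obtain d where d: "\<And>x. x \<in> dwindling_ct_instances \<Longrightarrow>
      computes d [encode_instance x] (if x \<in> ct_yes_instances then 1 else 0)"
    unfolding decidable_problem_def by blast
  obtain rs n where n: "n = list_encode (map encode_rule rs)"
    and inst: "instance_of rs n \<in> dwindling_ct_instances"
    and yes: "instance_of rs n \<in> ct_yes_instances \<longleftrightarrow> (\<exists>y. computes (halt_on_zero d) [n] y)"
    using halting_instances[of "halt_on_zero d"] unfolding Let_def by blast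
  let ?e = "encode_instance (instance_of rs n)"
  have "instance_of rs n \<in> ct_yes_instances \<longleftrightarrow> computes d [?e] 0"
    unfolding yes by (rule computes_halt_on_zero_iff[OF computes_rinstance[OF n]])
  also have "\<dots> \<longleftrightarrow> instance_of rs n \<notin> ct_yes_instances"
    using d[OF inst] computes_functional[of d "[?e]"] by (metis zero_neq_one)
  finally show False by blast
qed

end
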